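(* Let $n=4m\to\infty$ and let the parameter $a=a_n>0$ satisfy $an\to4\nu$ for some $\nu>0$. Then one sees the discrete Bessel kernel, in the following sense. Let $\tilde\alpha_i,\tilde\alpha_j\in2\mathbb Z$ lie in a bounded set, and put $$\tilde x_j=(x_1,x_2)=(\tfrac n2+1+\tilde\alpha_j)(1,1)+(0,-1),\qquad \tilde y_i=(y_1,y_2)=(\tfrac n2+1+\tilde\alpha_i)(1,1)+(-1,0).$$ Then, as $n\to\infty$, $$-a\,\mathrm i\,B_{0,0}(a,\tilde x_j,\tilde y_i)\longrightarrow\frac1{(2\pi\mathrm i)^2}\int_{\Gamma_r}\frac{dw_1}{w_1}\int_{\Gamma_{1/r}}dw_2\,\frac{w_2}{w_2^2-w_1^2}\,\frac{e^{\frac\nu2(w_1^2-1/w_1^2)+\tilde\alpha_j\log(w_1)}}{e^{\frac\nu2(w_2^2-1/w_2^2)+\tilde\alpha_i\log(w_2)}}\,\frac{w_1}{w_2},$$ and, by the change of variables $w_1^2=w$, $w_2^2=z$, the integral on the right-hand side is $$\mathbb K_{Bessel}(\tilde\alpha_i,\tilde\alpha_j,(\nu/2)^2)=\frac1{(2\pi\mathrm i)^2}\iint_{|z|>|w|}dz\,dw\,\frac{e^{\frac\nu2(z-z^{-1}-w+w^{-1})}}{z-w}\,\frac1{z^{\tilde\alpha_i+1/2}\,w^{-\tilde\alpha_j+1/2}}.$$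
   Context: Here $\mathrm i=\sqrt{-1}$, $\Gamma_\rho$ is the circle of radius $\rho$ centred at $0$ (positively oriented), $r<1$, and the $z$ and $w$ contours in $\mathbb K_{Bessel}$ go around $0$ with $|z|>|w|$. Put $c=a/(1+a^2)$; $\sqrt{w^2+2c}:=\exp(\frac12\log(w+\mathrm i\sqrt{2c})+\frac12\log(w-\mathrm i\sqrt{2c}))$ with arguments in $(-\pi/2,3\pi/2)$, $\sqrt{w^{-2}+2c}$ is the value of this function at $1/w$, $s(w)=w\sqrt{w^{-2}+2c}$, and $$G(w)=\frac1{\sqrt{2c}}\big(w-\sqrt{w^2+2c}\big),\qquad H_{x_1,x_2}(w)=\frac{w^{n/2}G(w)^{(n-x_1)/2}}{G(w^{-1})^{(n-x_2)/2}}.$$ For $\sqrt{2c}<r<1$, $$B_{0,0}(a,\tilde x_j,\tilde y_i)=\frac{\mathrm i^{(x_2-x_1+y_1-y_2)/2}}{(2\pi\mathrm i)^2}\int_{\Gamma_r}\frac{dw_1}{w_1}\int_{\Gamma_{1/r}}dw_2\,\frac{w_2}{w_2^2-w_1^2}\,\frac{H_{x_1+1,x_2}(w_1)}{H_{y_1,y_2+1}(w_2)}\,V_{0,0}(w_1,w_2),$$ where $$V_{0,0}(w_1,w_2)=\sum_{\gamma_1,\gamma_2=0}^1\frac{(-1)^{\gamma_1+\gamma_2}s(w_1)^{\gamma_1}s(w_2^{-1})^{\gamma_2}\,\tilde y_{\gamma_1,\gamma_2}(G(w_1),G(w_2^{-1}))}{4(1+a^2)^2G(w_1)G(w_2^{-1})\prod_{j=1}^2\sqrt{w_j^2+2c}\sqrt{w_j^{-2}+2c}}$$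 and $\tilde y_{0,0}(u,v)=\frac{a}{4(a^2+1)^2}\big(2a^6u^2v^2-a^4(1+u^4+u^2v^2-u^4v^2+v^4-u^2v^4)-a^2(1+3u^2+3v^2+2u^2v^2+u^4v^2+u^2v^4-u^4v^4)-(1+v^2+u^2+3u^2v^2)\big)$, $\tilde y_{0,1}(u,v)=\frac a{4(a^2+1)}(1+a^2u^2)(2a^2v^2+1+v^2-u^2+u^2v^2)$, $\tilde y_{1,0}(u,v)=\frac a{4(a^2+1)}(1+a^2v^2)(2a^2u^2+1-v^2+u^2+u^2v^2)$, $\tilde y_{1,1}(u,v)=\frac a4(2a^2u^2v^2-1+v^2+u^2+u^2v^2)$. The vertices $\tilde x_j$ and $\tilde y_i$ are the white vertex of one $a$-edge $e_j$ and the black vertex of another $a$-edge $e_i$ of the two-periodic Aztec diamond graph of size $n$ with edge weights $a$ and $1$. Both edges join a white vertex to a black vertex, each of whose coordinates sum to $1$ modulo $4$ (types $W_0$ and $B_0$, i.e. $\varepsilon_1=\varepsilon_2=0$). $B_{0,0}$ is one of the terms in the formula for the inverse Kasteleyn matrix of this model; multiplied by $-a\mathrm i$, it gives the corresponding part of the correlation kernel of the $a$-dimers.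
   Formalization: The printed factor w1/w2 makes the limit integral vanish; it is corrected to (w1/w2)^2. That integral is then (-1)^{(α_i-α_j)/2} K_Bessel((α_i+1)/2,(α_j+1)/2,(ν/2)^2), not K_Bessel(α_i,α_j,(ν/2)^2), whose half-integer powers are not single-valued. *)

theory Defs
  imports "HOL-Complex_Analysis.Complex_Analysis"
begin

definition c_par :: "real \<Rightarrow> real" where
  "c_par a = a / (1 + a\<^sup>2)"

text \<open>
  The logarithm whose argument lies in (-pi/2, 3 pi/2). On the negative imaginary axis it takes
  the argument 3 pi/2, which is the choice that makes the square root below continuous there.
\<close>

definition log_down :: "complex \<Rightarrow> complex" where
  "log_down z = Ln (- \<i> * z) + \<i> * of_real (pi / 2)"

text \<open>
  The function written sqrt (w^2 + 2 c). Its branch cut is the segment between the two branch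
  points, and it behaves like w at infinity; it is not \<^term>\<open>csqrt (w\<^sup>2 + 2 * c)\<close>.
\<close>

definition sqrt_c :: "real \<Rightarrow> complex \<Rightarrow> complex" where
  "sqrt_c a w = exp (1/2 * log_down (w + \<i> * of_real (sqrt (2 * c_par a)))
                   + 1/2 * log_down (w - \<i> * of_real (sqrt (2 * c_par a))))"

definition s_fun :: "real \<Rightarrow> complex \<Rightarrow> complex" where
  "s_fun a w = w * sqrt_c a (1 / w)"

definition G_fun :: "real \<Rightarrow> complex \<Rightarrow> complex" where
  "G_fun a w = 1 / of_real (sqrt (2 * c_par a)) * (w - sqrt_c a w)"

text \<open>
  The exponents are integers: in the definition of \<open>B00\<close> below, \<open>n\<close> is even and \<open>H_fun\<close> is only
  applied to arguments \<open>x1\<close>, \<open>x2\<close> that are both even, so each \<open>div 2\<close> is an exact division.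
\<close>

definition H_fun :: "real \<Rightarrow> nat \<Rightarrow> int \<Rightarrow> int \<Rightarrow> complex \<Rightarrow> complex" where
  "H_fun a n x1 x2 w =
     w ^ (n div 2) * G_fun a w powi ((int n - x1) div 2) / G_fun a (1 / w) powi ((int n - x2) div 2)"

definition y00 :: "complex \<Rightarrow> complex \<Rightarrow> complex \<Rightarrow> complex" where
  "y00 a u v = a / (4 * (a^2 + 1)^2) *
     (2 * a^6 * u^2 * v^2
      - a^4 * (1 + u^4 + u^2 * v^2 - u^4 * v^2 + v^4 - u^2 * v^4)
      - a^2 * (1 + 3 * u^2 + 3 * v^2 + 2 * u^2 * v^2 + u^4 * v^2 + u^2 * v^4 - u^4 * v^4)
      - (1 + v^2 + u^2 + 3 * u^2 * v^2))"

definition y01 :: "complex \<Rightarrow> complex \<Rightarrow> complex \<Rightarrow> complex" where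
  "y01 a u v = a / (4 * (a^2 + 1)) * (1 + a^2 * u^2) *
     (2 * a^2 * v^2 + 1 + v^2 - u^2 + u^2 * v^2)"

definition y10 :: "complex \<Rightarrow> complex \<Rightarrow> complex \<Rightarrow> complex" where
  "y10 a u v = a / (4 * (a^2 + 1)) * (1 + a^2 * v^2) *
     (2 * a^2 * u^2 + 1 - v^2 + u^2 + u^2 * v^2)"

definition y11 :: "complex \<Rightarrow> complex \<Rightarrow> complex \<Rightarrow> complex" where
  "y11 a u v = a / 4 * (2 * a^2 * u^2 * v^2 - 1 + v^2 + u^2 + u^2 * v^2)"

definition y_tilde :: "real \<Rightarrow> nat \<Rightarrow> nat \<Rightarrow> complex \<Rightarrow> complex \<Rightarrow> complex" where
  "y_tilde a g1 g2 u v =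
     (if g1 = 0 then (if g2 = 0 then y00 (of_real a) u v else y01 (of_real a) u v)
      else (if g2 = 0 then y10 (of_real a) u v else y11 (of_real a) u v))"

definition V00 :: "real \<Rightarrow> complex \<Rightarrow> complex \<Rightarrow> complex" where
  "V00 a w1 w2 = (\<Sum>g1\<in>{0,1::nat}. \<Sum>g2\<in>{0,1::nat}.
     ((-1) ^ (g1 + g2) * s_fun a w1 ^ g1 * s_fun a (1 / w2) ^ g2
        * y_tilde a g1 g2 (G_fun a w1) (G_fun a (1 / w2)))
     / (4 * (1 + of_real a ^ 2) ^ 2 * G_fun a w1 * G_fun a (1 / w2)
        * (sqrt_c a w1 * sqrt_c a (1 / w1)) * (sqrt_c a w2 * sqrt_c a (1 / w2))))"

text \<open>
  The contours are the circles of radius \<open>r\<close> and \<open>1 / r\<close>, where sqrt (2 c) < r < 1.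
\<close>

definition B00 :: "real \<Rightarrow> nat \<Rightarrow> real \<Rightarrow> int \<times> int \<Rightarrow> int \<times> int \<Rightarrow> complex" where
  "B00 r n a x y = (case x of (x1, x2) \<Rightarrow> case y of (y1, y2) \<Rightarrow>
     \<i> powi ((x2 - x1 + y1 - y2) div 2) / (2 * of_real pi * \<i>)\<^sup>2 *
     contour_integral (circlepath 0 r) (\<lambda>w1. 1 / w1 *
       contour_integral (circlepath 0 (1 / r)) (\<lambda>w2.
         w2 / (w2\<^sup>2 - w1\<^sup>2) * (H_fun a n (x1 + 1) x2 w1 / H_fun a n y1 (y2 + 1) w2)
         * V00 a w1 w2)))"

definition x_vertex :: "nat \<Rightarrow> int \<Rightarrow> int \<times> int" where
  "x_vertex n \<alpha> = (int n div 2 + 1 + \<alpha>, int n div 2 + 1 + \<alpha> - 1)"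

definition y_vertex :: "nat \<Rightarrow> int \<Rightarrow> int \<times> int" where
  "y_vertex n \<alpha> = (int n div 2 + 1 + \<alpha> - 1, int n div 2 + 1 + \<alpha>)"

text \<open>
  The exponent of \<open>w1 / w2\<close> is 2, not 1 as printed in the source: one factor comes from
  \<open>1 / (G_fun a w1 * G_fun a (1 / w2))\<close> in \<open>V00\<close>, the other from the quotient of the two \<open>H_fun\<close>,
  because \<open>H_fun a n (x1 + 1) x2 w\<close> is asymptotic to a constant (depending on \<open>a\<close>) times
  \<open>w powi (\<alpha>j + 1) * exp (\<nu> / 2 * (w^2 - 1 / w^2))\<close> as \<open>a * n\<close> tends to \<open>4 * \<nu>\<close>. With exponent 1
  and \<open>\<alpha>j\<close> even, the integrand is an even function of \<open>w1\<close> and its integral over the circle is 0.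
\<close>

definition B00_limit :: "real \<Rightarrow> real \<Rightarrow> int \<Rightarrow> int \<Rightarrow> complex" where
  "B00_limit \<nu> r \<alpha>i \<alpha>j =
     1 / (2 * of_real pi * \<i>)\<^sup>2 *
     contour_integral (circlepath 0 r) (\<lambda>w1. 1 / w1 *
       contour_integral (circlepath 0 (1 / r)) (\<lambda>w2.
         w2 / (w2\<^sup>2 - w1\<^sup>2)
         * (exp (of_real (\<nu> / 2) * (w1\<^sup>2 - 1 / w1\<^sup>2) + of_int \<alpha>j * Ln w1)
            / exp (of_real (\<nu> / 2) * (w2\<^sup>2 - 1 / w2\<^sup>2) + of_int \<alpha>i * Ln w2))
         * (w1 / w2)\<^sup>2))"

text \<open>
  The discrete Bessel kernel, for \<open>x\<close>, \<open>y\<close> in Z + 1/2; then both \<open>powr\<close> have integer exponents and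
  are single-valued. The circles have radii \<open>R\<close> (for z) and \<open>\<rho>\<close> (for w) with R > \<open>\<rho>\<close> > 0.
  An even integer \<open>\<alpha>\<close> corresponds to the point \<open>(\<alpha> + 1) / 2\<close> of Z + 1/2. Substituting w1^2 = -w and
  w2^2 = -z in \<open>B00_limit\<close> produces this kernel up to the sign \<open>(-1) powi ((\<alpha>i - \<alpha>j) div 2)\<close>,
  which is a conjugation and does not affect determinants.
\<close>

definition K_Bessel :: "real \<Rightarrow> real \<Rightarrow> real \<Rightarrow> real \<Rightarrow> real \<Rightarrow> complex" where
  "K_Bessel R \<rho> x y \<theta> =
     1 / (2 * of_real pi * \<i>)\<^sup>2 *
     contour_integral (circlepath 0 \<rho>) (\<lambda>w.
       contour_integral (circlepath 0 R) (\<lambda>z.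
         exp (of_real (sqrt \<theta>) * (z - 1 / z - w + 1 / w)) / (z - w)
         * (1 / (z powr of_real (x + 1/2) * w powr of_real (- y + 1/2)))))"

end

(*
  Write k = sqrt(2c). For |w| > k the square root is w sqrt(1 + k^2/w^2) with the principal branch,
  so G(w) = -(k/w) / (1 + sqrt(1 + k^2/w^2)) and G(w)/G(1/w) = D(w)/w^2 with
  D(w) = (1 + sqrt(1 + k^2 w^2)) / (1 + sqrt(1 + k^2/w^2)) = 1 + (k^2/4)(w^2 - 1/w^2) + O(k^4).
  The factor w^(n/2) of H cancels, leaving the power D(w)^m with m k^2 -> 2 nu, which converges to
  exp((nu/2)(w^2 - 1/w^2)); the remaining factors 1/(G(w1) G(1/w2))^2 and V are elementary.
  The convergence is uniform on the compact product of the two circles because it holds along the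
  product filter of m -> infinity and (w1, w2) -> point of the torus.

  The limit becomes the Bessel kernel by w1^2 = -w, w2^2 = -z. Its independence of the radii is
  Cauchy's theorem on annuli: the inner integral is a Cauchy transform, holomorphic in w for |w| < R.
*)
theory Submission
  imports Defs
begin

section \<open>The square root and the function G\<close>

text \<open>As a tends to 0 the integrand is an indeterminate product. G has order sqrt a, so
  \<open>1/(G(w1) G(1/w2))^2\<close> has order 1/a^2, while the polynomials in V and the prefactor
  -a each contribute one power of a. The limit is therefore taken only after an exact rewriting in
  which these powers have cancelled and every remaining factor converges by itself; no error term
  has to be estimated. Of the two factors \<open>1/(G(w1) G(1/w2))\<close>, one stands in V and the
  other comes from the shift by one in the indices of the two H. The formulas for G(w) and G(1/w)
  need |w| > k and 1/|w| > k, and k < r < 1 gives both on both circles. The minus signs in the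
  substitution are forced: the exponents of the contour formula and of the kernel have opposite
  signs. A half turn maps each circle to itself, so its only trace is the sign coming from the
  integer powers.\<close>

lemma c_par_pos: "0 < a \<Longrightarrow> 0 < c_par a"
  by (simp add: c_par_def add_pos_pos)

text \<open>Both sides have the same square, so only a sign is at stake: it suffices that the left
  side divided by p has positive real part, which singles out the principal root.\<close>

lemma csqrt_shift_product:
  fixes p :: complex and k :: real
  assumes "0 \<le> k" "k < cmod p"
  shows "csqrt (p + of_real k) * csqrt (p - of_real k) = p * csqrt (1 - of_real (k\<^sup>2) / p\<^sup>2)"
proof -
  define A where "A = csqrt (p + of_real k)"
  define B where "B = csqrt (p - of_real k)"
  have p0: "p \<noteq> 0" using assms by auto
  have A2: "A\<^sup>2 = p + of_real k" and B2: "B\<^sup>2 = p - of_real k"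
    by (simp_all add: A_def B_def)
  \<comment> \<open>This is Re (A cnj B). Off the real axis, p + k and p - k share their imaginary
    part, so Im A and Im B have the same sign. On the real axis, k < |p| makes both roots positive
    reals or both positive multiples of i.\<close>
  have pos: "Re A * Re B + Im A * Im B > 0"
  proof (cases "Im p = 0")
    case False
    have ReA: "Re A > 0" "Re B > 0"
      using False csqrt_principal[of "p + of_real k"] csqrt_principal[of "p - of_real k"] A2 B2
      by (auto simp: A_def B_def less_eq_real_def power2_eq_square complex_eq_iff)
    have "2 * Re A * Im A = Im p" "2 * Re B * Im B = Im p"
      using A2 B2 by (auto simp: complex_eq_iff power2_eq_square mult_ac)
    then have "(2 * Re A * Im A) * (2 * Re B * Im B) > 0"
      using False by (auto simp: zero_less_mult_iff)
    then have "(4 * (Re A * Re B)) * (Im A * Im B) > 0"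
      by (simp add: algebra_simps)
    moreover have "4 * (Re A * Re B) > 0" using ReA by simp
    ultimately have "Im A * Im B > 0"
      using zero_less_mult_pos by blast
    with ReA show ?thesis by (simp add: add_pos_pos)
  next
    case True
    define x where "x = Re p"
    have px: "p = of_real x" using True by (simp add: x_def complex_eq_iff)
    then have "k < \<bar>x\<bar>" using assms by simp
    then consider "x > k" | "x < - k" by linarith
    then show ?thesis
    proof cases
      case 1
      then have "A = of_real (sqrt (x + k))" "B = of_real (sqrt (x - k))"
        using assms unfolding A_def B_def px
        by (simp_all flip: of_real_add of_real_diff add: csqrt_of_real_nonneg)
      with 1 assms show ?thesis by simp
    next
      case 2
      then have "A = \<i> * of_real (sqrt \<bar>x + k\<bar>)" "B = \<i> * of_real (sqrt \<bar>x - k\<bar>)"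
        using assms unfolding A_def B_def px
        by (simp_all flip: of_real_add of_real_diff add: csqrt_of_real_nonpos)
      with 2 assms show ?thesis by simp
    qed
  qed
  define X where "X = A * B / p"
  have "X\<^sup>2 = (A\<^sup>2 * B\<^sup>2) / p\<^sup>2"
    by (simp add: X_def power_mult_distrib power_divide)
  also have "\<dots> = 1 - of_real (k\<^sup>2) / p\<^sup>2"
    unfolding A2 B2 using p0 by (simp add: field_simps power2_eq_square)
  finally have X2: "X\<^sup>2 = 1 - of_real (k\<^sup>2) / p\<^sup>2" .
  \<comment> \<open>Since \<open>2 p = A\<^sup>2 + B\<^sup>2\<close>, the sign of \<open>Re (A B / p)\<close> is that of \<open>Re (A cnj B)\<close>.\<close>
  have "2 * (A * B * cnj p) = A * B * cnj (A\<^sup>2 + B\<^sup>2)"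
    unfolding A2 B2 by simp
  also have "\<dots> = (A * cnj A) * (B * cnj A) + (B * cnj B) * (A * cnj B)"
    by (simp add: algebra_simps power2_eq_square)
  finally have "2 * (A * B * cnj p) = of_real ((cmod A)\<^sup>2) * (B * cnj A) + of_real ((cmod B)\<^sup>2) * (A * cnj B)"
    by (simp only: complex_norm_square)
  then have "2 * Re (A * B * cnj p) = ((cmod A)\<^sup>2 + (cmod B)\<^sup>2) * (Re A * Re B + Im A * Im B)"
    by (simp add: complex_eq_iff algebra_simps)
  moreover have "A \<noteq> 0" using pos by auto
  ultimately have "Re (A * B * cnj p) > 0"
    using pos by (smt (verit) mult_pos_pos zero_le_power2 zero_less_norm_iff zero_less_power)
  then have "Re X > 0"
    unfolding X_def by (simp add: Re_complex_div_gt_0)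
  then have "csqrt (1 - of_real (k\<^sup>2) / p\<^sup>2) = X"
    using X2 by (intro csqrt_unique) auto
  then show ?thesis using p0 by (simp add: X_def A_def B_def)
qed

text \<open>
  Factoring \<open>w\<close> out of the two-branch square root leaves the principal square root of a number
  close to 1: \<open>sqrt_c a w = w * rho a (1 / w)\<close> outside the branch cut.
\<close>

definition rho :: "real \<Rightarrow> complex \<Rightarrow> complex" where
  "rho a w = csqrt (1 + of_real (2 * c_par a) * w\<^sup>2)"

lemma exp_half_log_down:
  assumes "z \<noteq> 0"
  shows "exp (1/2 * log_down z) = exp (\<i> * of_real (pi / 4)) * csqrt (- \<i> * z)"
proof -
  have "1/2 * log_down z = \<i> * of_real (pi / 4) + Ln (- \<i> * z) / 2"
    by (simp add: log_down_def field_simps)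
  then show ?thesis
    using assms by (simp only: exp_add) (simp add: csqrt_exp_Ln del: of_real_divide)
qed

text \<open>Rotation by -i moves the branch points from the imaginary to the real axis, the setting
  of \<open>csqrt_shift_product\<close> with p = -i w. The two phases exp (i pi / 4) multiply to i
  and undo the rotation.\<close>

lemma sqrt_c_eq:
  assumes "0 < a" "sqrt (2 * c_par a) < cmod w"
  shows "sqrt_c a w = w * rho a (1 / w)"
proof -
  define k where "k = sqrt (2 * c_par a)"
  have c: "c_par a > 0" using assms(1) by (rule c_par_pos)
  have k: "k > 0" "k\<^sup>2 = 2 * c_par a" using c by (auto simp: k_def)
  have wk: "k < cmod w" using assms by (simp add: k_def)
  have nz: "w + \<i> * of_real k \<noteq> 0" "w - \<i> * of_real k \<noteq> 0"
    using wk k by (auto simp: add_eq_0_iff2 norm_mult)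
  have "exp (\<i> * of_real (pi / 4)) ^ 2 = cis (real 2 * (pi / 4))"
    by (simp only: cis_conv_exp [symmetric] Complex.DeMoivre)
  then have exp_i_quarter: "exp (\<i> * of_real (pi / 4)) ^ 2 = \<i>"
    by simp
  have "sqrt_c a w = exp (1/2 * log_down (w + \<i> * of_real k)) * exp (1/2 * log_down (w - \<i> * of_real k))"
    by (simp add: sqrt_c_def k_def exp_add)
  also have "\<dots> = exp (\<i> * of_real (pi / 4)) ^ 2 * (csqrt (- \<i> * w + of_real k) * csqrt (- \<i> * w - of_real k))"
    unfolding exp_half_log_down[OF nz(1)] exp_half_log_down[OF nz(2)]
    by (simp add: power2_eq_square algebra_simps)
  also have "exp (\<i> * of_real (pi / 4)) ^ 2 = \<i>"
    using exp_i_quarter .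
  also have "csqrt (- \<i> * w + of_real k) * csqrt (- \<i> * w - of_real k) =
      (- \<i> * w) * csqrt (1 - of_real (k\<^sup>2) / (- \<i> * w)\<^sup>2)"
    using wk k by (intro csqrt_shift_product) (auto simp: norm_mult)
  finally show ?thesis
    by (simp add: rho_def k power_mult_distrib power_divide flip: mult.assoc)
qed

lemma one_plus_rho_neq_0: "1 + rho a w \<noteq> 0"
proof -
  have "Re (rho a w) \<ge> 0" unfolding rho_def using csqrt_principal by (metis less_eq_real_def)
  then show ?thesis by (auto simp: complex_eq_iff)
qed

text \<open>The defining form w (1 - R) / k, with R = \<open>rho a (1 / w)\<close>, is 0/0 as a
  tends to 0. Multiplying by the conjugate 1 + R and using R^2 - 1 = k^2 / w^2 exhibits the order k,
  with a denominator that never vanishes.\<close>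

lemma G_fun_eq:
  assumes "0 < a" "sqrt (2 * c_par a) < cmod w"
  shows "G_fun a w = - (of_real (sqrt (2 * c_par a)) / w) / (1 + rho a (1 / w))"
proof -
  define k where "k = sqrt (2 * c_par a)"
  have c: "c_par a > 0" using assms(1) by (rule c_par_pos)
  have k: "k > 0" "k\<^sup>2 = 2 * c_par a" using c by (auto simp: k_def)
  have w: "w \<noteq> 0" using assms k by (auto simp: k_def)
  define R where "R = rho a (1 / w)"
  have "R\<^sup>2 = 1 + of_real k ^ 2 / w\<^sup>2"
    by (simp add: R_def rho_def power_divide flip: k(2))
  then have "of_real k ^ 2 = w\<^sup>2 * (R\<^sup>2 - 1)" using w by simp
  then have R: "w * w * (1 - R) * (1 + R) = - (of_real k * of_real k)"
    by (simp add: power2_eq_square algebra_simps)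
  have "G_fun a w = w * (1 - R) / of_real k"
    unfolding G_fun_def sqrt_c_eq[OF assms] k_def[symmetric] R_def
    by (simp add: diff_divide_distrib algebra_simps)
  also have "\<dots> = - of_real k / (w * (1 + R))"
    using w k one_plus_rho_neq_0[of a "1 / w"] R
    by (subst frac_eq_eq) (simp_all add: R_def[symmetric] mult_ac)
  finally show ?thesis by (simp add: k_def R_def)
qed

section \<open>Convergence of iterated circle integrals\<close>

text \<open>An eventual rectangle of the product filter gives one threshold in i for a whole
  neighbourhood of x; finitely many neighbourhoods cover K. Uniform convergence can thus be proved
  with the ordinary limit rules, the point being one more convergent variable.\<close>

lemma uniform_limit_compactI:
  fixes f :: "'i \<Rightarrow> 'a::topological_space \<Rightarrow> 'b::metric_space"
  assumes K: "compact K" and l: "continuous_on K l"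
    and lim: "\<And>x. x \<in> K \<Longrightarrow> ((\<lambda>(i, y). f i y) \<longlongrightarrow> l x) (F \<times>\<^sub>F nhds x)"
  shows "uniform_limit K f l F"
proof (rule uniform_limitI)
  fix e :: real assume "e > 0"
  then have e: "e / 2 > 0" by simp
  have "\<exists>U. open U \<and> x \<in> U \<and> (\<forall>\<^sub>F i in F. \<forall>y \<in> U \<inter> K. dist (f i y) (l y) < e)" if x: "x \<in> K" for x
  proof -
    have "\<forall>\<^sub>F z in F \<times>\<^sub>F nhds x. dist (case z of (i, y) \<Rightarrow> f i y) (l x) < e / 2"
      using tendstoD[OF lim[OF x] e] .
    then obtain P Q where P: "eventually P F" and Q: "eventually Q (nhds x)"
      and PQ: "\<And>i y. P i \<Longrightarrow> Q y \<Longrightarrow> dist (f i y) (l x) < e / 2"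
      unfolding eventually_prod_filter by auto
    obtain U where U: "open U" "x \<in> U" "\<And>y. y \<in> U \<Longrightarrow> Q y"
      using Q unfolding eventually_nhds by auto
    obtain V where V: "open V" "x \<in> V" "\<And>y. y \<in> K \<Longrightarrow> y \<in> V \<Longrightarrow> l y \<in> ball (l x) (e / 2)"
      using l[unfolded continuous_on_topological] x e by (metis centre_in_ball open_ball)
    have "\<forall>\<^sub>F i in F. \<forall>y \<in> (U \<inter> V) \<inter> K. dist (f i y) (l y) < e"
      using P
    proof eventually_elim
      case (elim i)
      show ?case
      proof
        fix y assume y: "y \<in> (U \<inter> V) \<inter> K"
        have "dist (f i y) (l x) < e / 2" using PQ[OF elim] U(3) y by blast
        moreover have "dist (l x) (l y) < e / 2" using V(3)[of y] y by auto
        ultimately show "dist (f i y) (l y) < e"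
          using dist_triangle[of "f i y" "l y" "l x"] by linarith
      qed
    qed
    then show ?thesis using U V by (intro exI[of _ "U \<inter> V"]) auto
  qed
  then have "\<forall>x\<in>K. \<exists>U. open U \<and> x \<in> U \<and> (\<forall>\<^sub>F i in F. \<forall>y \<in> U \<inter> K. dist (f i y) (l y) < e)"
    by blast
  from bchoice[OF this] obtain U where U: "\<And>x. x \<in> K \<Longrightarrow> open (U x)" "\<And>x. x \<in> K \<Longrightarrow> x \<in> U x"
    "\<And>x. x \<in> K \<Longrightarrow> \<forall>\<^sub>F i in F. \<forall>y \<in> U x \<inter> K. dist (f i y) (l y) < e"
    by blast
  obtain C where C: "C \<subseteq> K" "finite C" "K \<subseteq> (\<Union>x\<in>C. U x)"
    by (rule compactE_image[OF K, of K U]) (use U in auto)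
  have "\<forall>\<^sub>F i in F. \<forall>x\<in>C. \<forall>y \<in> U x \<inter> K. dist (f i y) (l y) < e"
    using C U(3) by (intro eventually_ball_finite) auto
  then show "\<forall>\<^sub>F i in F. \<forall>y\<in>K. dist (f i y) (l y) < e"
    by eventually_elim (use C in blast)
qed

lemma uniform_limit_finite:
  assumes "finite X" "\<And>x. x \<in> X \<Longrightarrow> ((\<lambda>i. f i x) \<longlongrightarrow> l x) F"
  shows "uniform_limit X f l F"
  using assms by (intro uniform_limitI eventually_ball_finite) (auto intro: tendstoD)

lemma continuous_on_contour_integral_circlepath:
  fixes f :: "'a::topological_space \<times> complex \<Rightarrow> complex"
  assumes f: "continuous_on (S \<times> sphere 0 R) f" and R: "R > 0"
  shows "continuous_on S (\<lambda>w. contour_integral (circlepath 0 R) (\<lambda>z. f (w, z)))"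
proof -
  have "continuous_on (S \<times> cbox 0 1)
     (\<lambda>(w, t). f (w, circlepath 0 R t) * vector_derivative (circlepath 0 R) (at t))"
    unfolding vector_derivative_circlepath unfolding circlepath case_prod_unfold using R
    by (intro continuous_intros continuous_on_compose2[OF f]) (auto simp: norm_mult)
  then show ?thesis
    unfolding contour_integral_integral
    using integral_continuous_on_param[of S 0 1 "\<lambda>w t. f (w, circlepath 0 R t) * vector_derivative (circlepath 0 R) (at t)"]
    by (simp add: box_real)
qed

lemma tendsto_double_contour_integral:
  fixes f :: "'i \<Rightarrow> complex \<times> complex \<Rightarrow> complex"
  assumes F: "F \<noteq> bot" and r: "r > 0" and R: "R > 0"
    and cont: "\<forall>\<^sub>F i in F. continuous_on (sphere 0 r \<times> sphere 0 R) (f i)"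
    and lim: "uniform_limit (sphere 0 r \<times> sphere 0 R) f l F"
  shows "((\<lambda>i. contour_integral (circlepath 0 r) (\<lambda>w. 1 / w * contour_integral (circlepath 0 R) (\<lambda>z. f i (w, z))))
     \<longlongrightarrow> contour_integral (circlepath 0 r) (\<lambda>w. 1 / w * contour_integral (circlepath 0 R) (\<lambda>z. l (w, z)))) F"
proof (rule contour_integral_uniform_limit)
  have l: "continuous_on (sphere 0 r \<times> sphere 0 R) l"
    using uniform_limit_theorem[OF cont lim F] .
  let ?J = "\<lambda>g w. contour_integral (circlepath 0 R) (\<lambda>z. g (w, z))"
  show "\<forall>\<^sub>F i in F. (\<lambda>w. 1 / w * ?J (f i) w) contour_integrable_on circlepath 0 r"
    using cont
  proof eventually_elim
    case (elim i)
    show ?case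
      using continuous_on_contour_integral_circlepath[OF elim R] r
      by (intro contour_integrable_continuous_circlepath continuous_intros) auto
  qed
  have int: "(\<lambda>z. g (w, z)) contour_integrable_on circlepath 0 R"
    if "continuous_on (sphere 0 r \<times> sphere 0 R) g" "w \<in> sphere 0 r" for g :: "complex \<times> complex \<Rightarrow> complex" and w
    using R that by (intro contour_integrable_continuous_circlepath continuous_on_compose2[OF that(1)] continuous_intros) auto
  have "uniform_limit (sphere 0 r) (\<lambda>i. ?J (f i)) (?J l) F"
  proof (rule uniform_limitI)
    fix e :: real assume e: "e > 0"
    \<comment> \<open>Half of e divided by the length of the circle: the integral bound becomes e /
      2, strictly below e.\<close>
    define d where "d = e / (4 * pi * R)"
    have d: "d > 0" using e R by (simp add: d_def)
    from uniform_limitD[OF lim d] cont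
    show "\<forall>\<^sub>F i in F. \<forall>w\<in>sphere 0 r. dist (?J (f i) w) (?J l w) < e"
    proof eventually_elim
      case (elim i)
      show ?case
      proof
        fix w :: complex assume w: "w \<in> sphere 0 r"
        have "((\<lambda>z. f i (w, z) - l (w, z)) has_contour_integral (?J (f i) w - ?J l w)) (circlepath 0 R)"
          using elim l w by (intro has_contour_integral_diff has_contour_integral_integral int)
        then have "norm (?J (f i) w - ?J l w) \<le> d * (2 * pi * R)"
          using elim w d R
          by (rule_tac has_contour_integral_bound_circlepath) (auto simp: dist_norm less_imp_le)
        also have "d * (2 * pi * R) < e" using e R by (simp add: d_def field_simps)
        finally show "dist (?J (f i) w) (?J l w) < e" by (simp add: dist_norm)
      qed
    qed
  qed
  moreover have "bounded ((\<lambda>w. 1 / w :: complex) ` sphere 0 r)" "bounded (?J l ` sphere 0 r)"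
    using r continuous_on_contour_integral_circlepath[OF l R]
    by (auto intro!: compact_imp_bounded compact_continuous_image continuous_intros)
  ultimately show "uniform_limit (path_image (circlepath 0 r)) (\<lambda>i w. 1 / w * ?J (f i) w) (\<lambda>w. 1 / w * ?J l w) F"
    using r by (simp only: path_image_circlepath_nonneg less_imp_le)
      (intro uniform_lim_mult uniform_limit_const)
  show "norm (vector_derivative (circlepath 0 r) (at t)) \<le> 2 * pi * r" for t
    using r by (simp add: vector_derivative_circlepath norm_mult)
qed (use F in auto)

section \<open>Pointwise asymptotics of the integrand\<close>

text \<open>The power equals exp (N U q(U)), where q(u) = Ln (1 + u) / u is continued by q(0) = 1.
  The continuous q also covers the points where U vanishes.\<close>

lemma tendsto_one_plus_power:
  fixes U :: "'a \<Rightarrow> complex" and N :: "'a \<Rightarrow> nat"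
  assumes U: "(U \<longlongrightarrow> 0) F" and NU: "((\<lambda>x. of_nat (N x) * U x) \<longlongrightarrow> L) F"
  shows "((\<lambda>x. (1 + U x) ^ N x) \<longlongrightarrow> exp L) F"
proof -
  define q :: "complex \<Rightarrow> complex" where "q u = (if u = 0 then 1 else Ln (1 + u) / u)" for u
  have "(Ln has_field_derivative inverse 1) (at 1)"
    by (rule has_field_derivative_Ln) auto
  then have "((\<lambda>u. Ln (1 + u) / u) \<longlongrightarrow> 1) (at 0)"
    by (simp add: has_field_derivative_def has_derivative_at DERIV_def flip: has_field_derivative_def)
  then have "(q \<longlongrightarrow> 1) (at 0)"
    by (rule Lim_transform_eventually) (auto simp: q_def eventually_at_filter)
  then have "isCont q 0" by (simp add: isCont_def q_def)
  then have "((\<lambda>x. q (U x)) \<longlongrightarrow> q 0) F"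
    using U by (rule isCont_tendsto_compose)
  then have "((\<lambda>x. exp (of_nat (N x) * U x * q (U x))) \<longlongrightarrow> exp (L * q 0)) F"
    by (intro tendsto_intros NU)
  moreover have "\<forall>\<^sub>F x in F. exp (of_nat (N x) * U x * q (U x)) = (1 + U x) ^ N x"
  proof -
    have "((\<lambda>x. 1 + U x) \<longlongrightarrow> 1 + 0) F" by (intro tendsto_intros U)
    then have "\<forall>\<^sub>F x in F. 1 + U x \<noteq> 0"
      by (rule tendsto_imp_eventually_ne) simp
    then show ?thesis
      by eventually_elim (auto simp: q_def exp_of_nat_mult)
  qed
  ultimately show ?thesis
    by (auto intro: Lim_transform_eventually simp: q_def)
qed

lemma tendsto_c_par:
  assumes "(A \<longlongrightarrow> 0) F"
  shows "((\<lambda>x. c_par (A x)) \<longlongrightarrow> 0) F"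
proof -
  have "((\<lambda>x. c_par (A x)) \<longlongrightarrow> 0 / (1 + 0\<^sup>2)) F"
    unfolding c_par_def by (intro tendsto_intros assms) auto
  then show ?thesis by simp
qed

lemma tendsto_rho:
  assumes A: "(A \<longlongrightarrow> 0) F" and W: "(W \<longlongrightarrow> w) F"
  shows "((\<lambda>x. rho (A x) (W x)) \<longlongrightarrow> 1) F"
proof -
  have "isCont csqrt 1" by (rule continuous_at_csqrt) auto
  moreover have "((\<lambda>x. 1 + of_real (2 * c_par (A x)) * (W x)\<^sup>2) \<longlongrightarrow> 1 + of_real (2 * 0) * w\<^sup>2) F"
    by (intro tendsto_intros tendsto_c_par A W)
  ultimately show ?thesis
    unfolding rho_def using isCont_tendsto_compose by fastforce
qed

definition D_fun :: "real \<Rightarrow> complex \<Rightarrow> complex" where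
  "D_fun a w = (1 + rho a w) / (1 + rho a (1 / w))"

lemma rho_minus_1: "rho a w - 1 = of_real (2 * c_par a) * w\<^sup>2 / (1 + rho a w)"
proof -
  have "(rho a w - 1) * (1 + rho a w) = (rho a w)\<^sup>2 - 1" by (simp add: power2_eq_square algebra_simps)
  also have "\<dots> = of_real (2 * c_par a) * w\<^sup>2" by (simp add: rho_def)
  finally show ?thesis using one_plus_rho_neq_0[of a w] by (simp add: eq_divide_eq)
qed

text \<open>An exact identity in place of an expansion in k: the small factor 2c is pulled out
  completely and its cofactor converges.\<close>

lemma D_fun_minus_1:
  "D_fun a w - 1 = of_real (2 * c_par a) *
     ((w\<^sup>2 / (1 + rho a w) - (1 / w)\<^sup>2 / (1 + rho a (1 / w))) / (1 + rho a (1 / w)))"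
proof -
  have "D_fun a w - 1 = ((rho a w - 1) - (rho a (1 / w) - 1)) / (1 + rho a (1 / w))"
    using one_plus_rho_neq_0[of a "1 / w"] by (simp add: D_fun_def divide_simps)
  then show ?thesis
    unfolding rho_minus_1 by (simp add: right_diff_distrib)
qed

lemma tendsto_D_fun:
  assumes A: "(A \<longlongrightarrow> 0) F" and W: "(W \<longlongrightarrow> w) F" and w: "w \<noteq> 0"
  shows "((\<lambda>x. D_fun (A x) (W x)) \<longlongrightarrow> 1) F"
proof -
  have "((\<lambda>x. D_fun (A x) (W x)) \<longlongrightarrow> (1 + 1) / (1 + 1)) F"
    unfolding D_fun_def using w by (intro tendsto_intros tendsto_rho[where w = w] tendsto_rho[where w = "1 / w"] A W) auto
  then show ?thesis by simp
qed

text \<open>By \<open>D_fun_minus_1\<close>, N (D - 1) is N * 2c, which tends to 2 \<nu>, times a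
  cofactor tending to (w^2 - 1/w^2) / 4. This is the origin of \<nu> / 2.\<close>

lemma tendsto_D_fun_power:
  fixes N :: "'a \<Rightarrow> nat"
  assumes A: "(A \<longlongrightarrow> 0) F" and W: "(W \<longlongrightarrow> w) F" and w: "w \<noteq> 0"
    and NA: "((\<lambda>x. real (N x) * A x) \<longlongrightarrow> \<nu>) F"
  shows "((\<lambda>x. D_fun (A x) (W x) ^ N x) \<longlongrightarrow> exp (of_real (\<nu> / 2) * (w\<^sup>2 - 1 / w\<^sup>2))) F"
proof -
  have "((\<lambda>x. D_fun (A x) (W x) - 1) \<longlongrightarrow> 1 - 1) F"
    by (intro tendsto_intros tendsto_D_fun[OF A W w])
  moreover have "((\<lambda>x. of_nat (N x) * (D_fun (A x) (W x) - 1)) \<longlongrightarrow> of_real (\<nu> / 2) * (w\<^sup>2 - 1 / w\<^sup>2)) F"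
  proof -
    have "((\<lambda>x. 2 * (real (N x) * A x) / (1 + (A x)\<^sup>2)) \<longlongrightarrow> 2 * \<nu> / (1 + 0\<^sup>2)) F"
      by (intro tendsto_intros NA A) auto
    then have NC: "((\<lambda>x. real (N x) * (2 * c_par (A x))) \<longlongrightarrow> 2 * \<nu>) F"
      by (simp add: c_par_def mult_ac)
    have W': "((\<lambda>x. 1 / W x) \<longlongrightarrow> 1 / w) F"
      using w by (intro tendsto_intros W)
    have "((\<lambda>x. of_real (real (N x) * (2 * c_par (A x))) *
       (((W x)\<^sup>2 / (1 + rho (A x) (W x)) - (1 / W x)\<^sup>2 / (1 + rho (A x) (1 / W x))) / (1 + rho (A x) (1 / W x))))
       \<longlongrightarrow> of_real (2 * \<nu>) * ((w\<^sup>2 / (1 + 1) - (1 / w)\<^sup>2 / (1 + 1)) / (1 + 1))) F"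
      by (intro tendsto_mult[OF tendsto_of_real[OF NC]] tendsto_divide tendsto_diff tendsto_add tendsto_power
          tendsto_const tendsto_rho[OF A W] tendsto_rho[OF A W'] W W') simp_all
    moreover have "of_real (2 * \<nu>) * ((w\<^sup>2 / (1 + 1) - (1 / w)\<^sup>2 / (1 + 1)) / (1 + 1)) = of_real (\<nu> / 2) * (w\<^sup>2 - 1 / w\<^sup>2)"
      by (simp add: power_divide flip: diff_divide_distrib)
    ultimately show ?thesis
      unfolding D_fun_minus_1 by (simp only: of_real_mult of_real_of_nat_eq mult.assoc)
  qed
  ultimately show ?thesis
    using tendsto_one_plus_power[of "\<lambda>x. D_fun (A x) (W x) - 1" F N] by simp
qed

section \<open>Leading order of the polynomials in V\<close>

definition Y_sum :: "real \<Rightarrow> complex \<Rightarrow> complex \<Rightarrow> complex \<Rightarrow> complex \<Rightarrow> complex" where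
  "Y_sum a s1 s2 u v = y00 (of_real a) u v - s2 * y01 (of_real a) u v - s1 * y10 (of_real a) u v
     + s1 * s2 * y11 (of_real a) u v"

text \<open>As a, u and v tend to 0, only the constant terms of the brackets survive: -1, 1, 1, -1,
  each with weight a / 4. The alternating signs of the sum turn all four into -a / 4.\<close>

lemma tendsto_Y_sum:
  assumes A: "(A \<longlongrightarrow> 0) F" and nz: "\<forall>\<^sub>F x in F. A x \<noteq> 0"
    and S: "(S1 \<longlongrightarrow> 1) F" "(S2 \<longlongrightarrow> 1) F" and U: "(U \<longlongrightarrow> 0) F" and V: "(V \<longlongrightarrow> 0) F"
  shows "((\<lambda>x. Y_sum (A x) (S1 x) (S2 x) (U x) (V x) / of_real (A x)) \<longlongrightarrow> -1) F"
proof -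
  define B where "B x = complex_of_real (A x)" for x
  have B: "(B \<longlongrightarrow> 0) F"
    unfolding B_def using tendsto_of_real[OF A] by simp
  have BB: "((\<lambda>x. B x / B x) \<longlongrightarrow> 1) F"
    by (rule tendsto_eventually, use nz in eventually_elim) (auto simp: B_def)
  \<comment> \<open>The quotient a / a is kept as a separate factor because it is 1 only where a is
    nonzero, which is known only eventually.\<close>
  have pull: "a / d * P / a = a / a * (P / d)" "a / d * P * P' / a = a / a * (P * P' / d)" for a d P P' :: complex
    by simp_all
  have y00: "((\<lambda>x. y00 (B x) (U x) (V x) / B x) \<longlongrightarrow> 1 * ((- 1) / (4 * 1))) F"
    unfolding y00_def pull
    by (rule tendsto_mult[OF BB]) (rule tendsto_eq_intros B U V refl | simp)+
  have y01: "((\<lambda>x. y01 (B x) (U x) (V x) / B x) \<longlongrightarrow> 1 * (1 / (4 * 1))) F"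
    unfolding y01_def pull
    by (rule tendsto_mult[OF BB]) (rule tendsto_eq_intros B U V refl | simp)+
  have y10: "((\<lambda>x. y10 (B x) (U x) (V x) / B x) \<longlongrightarrow> 1 * (1 / (4 * 1))) F"
    unfolding y10_def pull
    by (rule tendsto_mult[OF BB]) (rule tendsto_eq_intros B U V refl | simp)+
  have y11: "((\<lambda>x. y11 (B x) (U x) (V x) / B x) \<longlongrightarrow> 1 * ((- 1) / 4)) F"
    unfolding y11_def pull
    by (rule tendsto_mult[OF BB]) (rule tendsto_eq_intros B U V refl | simp)+
  have "((\<lambda>x. y00 (B x) (U x) (V x) / B x - S2 x * (y01 (B x) (U x) (V x) / B x)
     - S1 x * (y10 (B x) (U x) (V x) / B x) + S1 x * S2 x * (y11 (B x) (U x) (V x) / B x))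
     \<longlongrightarrow> 1 * ((- 1) / (4 * 1)) - 1 * (1 * (1 / (4 * 1))) - 1 * (1 * (1 / (4 * 1))) + 1 * 1 * (1 * ((- 1) / 4))) F"
    by (intro tendsto_intros y00 y01 y10 y11 S)
  then show ?thesis
    by (simp add: Y_sum_def B_def[symmetric] add_divide_distrib diff_divide_distrib)
qed

section \<open>Exact factorisation of the integrand\<close>

lemma sqrt_c_inverse_eq:
  assumes "0 < a" "sqrt (2 * c_par a) < 1 / cmod w"
  shows "sqrt_c a (1 / w) = rho a w / w"
  using sqrt_c_eq[of a "1 / w"] assms by (simp add: norm_divide)

lemma G_fun_inverse_eq:
  assumes "0 < a" "sqrt (2 * c_par a) < 1 / cmod w"
  shows "G_fun a (1 / w) = - (of_real (sqrt (2 * c_par a)) * w) / (1 + rho a w)"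
  using G_fun_eq[of a "1 / w"] assms by (simp add: norm_divide)

text \<open>For n = 4m the factor w^(n/2) absorbs all of w^(-2(m - q)) except
  \<open>w powi (2 * q)\<close>. The power of D is split because only \<open>D_fun a w ^ m\<close>
  has a growing exponent; the fixed power \<open>D_fun a w powi q\<close> tends to 1.\<close>

lemma G_fun_quotient_power:
  fixes m :: nat
  assumes a: "0 < a" and w: "sqrt (2 * c_par a) < cmod w" "sqrt (2 * c_par a) < 1 / cmod w"
  shows "w ^ (2 * m) * G_fun a w powi (int m - q) / G_fun a (1 / w) powi (int m - q) =
    w powi (2 * q) * (D_fun a w ^ m / D_fun a w powi q)"
    and "G_fun a w \<noteq> 0" "G_fun a (1 / w) \<noteq> 0"
proof -
  have c: "c_par a > 0" using a by (rule c_par_pos)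
  have k: "sqrt (2 * c_par a) > 0" using c by simp
  have w0: "w \<noteq> 0" using w k by auto
  note nz = one_plus_rho_neq_0[of a w] one_plus_rho_neq_0[of a "1 / w"]
  have D0: "D_fun a w \<noteq> 0" using nz by (simp add: D_fun_def)
  show G0: "G_fun a w \<noteq> 0" "G_fun a (1 / w) \<noteq> 0"
    unfolding G_fun_eq[OF a w(1)] G_fun_inverse_eq[OF a w(2)] using k w0 nz c by auto
  have "G_fun a w / G_fun a (1 / w) = D_fun a w / w\<^sup>2"
    unfolding G_fun_eq[OF a w(1)] G_fun_inverse_eq[OF a w(2)] D_fun_def
    using k w0 nz c by (simp add: divide_simps power2_eq_square)
  then have "G_fun a w powi (int m - q) / G_fun a (1 / w) powi (int m - q) = (D_fun a w / w\<^sup>2) powi (int m - q)"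
    by (simp flip: power_int_divide_distrib)
  also have "\<dots> = (D_fun a w ^ m / D_fun a w powi q) * (w powi (2 * q) / w ^ (2 * m))"
    using D0 w0 by (simp add: power_int_divide_distrib power_int_diff power_int_mult power_mult)
  finally have ratio: "G_fun a w powi (int m - q) / G_fun a (1 / w) powi (int m - q) =
     (D_fun a w ^ m / D_fun a w powi q) * (w powi (2 * q) / w ^ (2 * m))" .
  show "w ^ (2 * m) * G_fun a w powi (int m - q) / G_fun a (1 / w) powi (int m - q) =
    w powi (2 * q) * (D_fun a w ^ m / D_fun a w powi q)"
    unfolding times_divide_eq_right[symmetric] ratio using w0 by simp
qed

text \<open>The two indices differ by 2, so the exponents of G(w) and G(1/w) are m - q - 1 and m -
  q; the missing power is the extra 1 / G(w). For the y-vertex the defect sits on G(1/w), so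
  dividing by that H gives the extra 1 / G(1/w2).\<close>

lemma H_fun_x_eq:
  fixes m :: nat
  assumes a: "0 < a" and w: "sqrt (2 * c_par a) < cmod w" "sqrt (2 * c_par a) < 1 / cmod w"
  shows "H_fun a (4 * m) (int (4 * m) div 2 + 1 + 2 * q + 1) (int (4 * m) div 2 + 1 + 2 * q - 1) w =
    w powi (2 * q) * (D_fun a w ^ m / D_fun a w powi q) / G_fun a w"
proof -
  have e: "(int (4 * m) - (int (4 * m) div 2 + 1 + 2 * q + 1)) div 2 = int m - q - 1"
    "(int (4 * m) - (int (4 * m) div 2 + 1 + 2 * q - 1)) div 2 = int m - q" "4 * m div 2 = 2 * m"
    by simp_all
  show ?thesis
    unfolding H_fun_def e G_fun_quotient_power(1)[OF assms, where m = m and q = q, symmetric]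
    using G_fun_quotient_power(2,3)[OF assms] power_int_diff[of "G_fun a w" "int m - q" 1] by (simp add: mult_ac)
qed

lemma H_fun_y_eq:
  fixes m :: nat
  assumes a: "0 < a" and w: "sqrt (2 * c_par a) < cmod w" "sqrt (2 * c_par a) < 1 / cmod w"
  shows "H_fun a (4 * m) (int (4 * m) div 2 + 1 + 2 * p - 1) (int (4 * m) div 2 + 1 + 2 * p + 1) w =
    w powi (2 * p) * (D_fun a w ^ m / D_fun a w powi p) * G_fun a (1 / w)"
proof -
  have e: "(int (4 * m) - (int (4 * m) div 2 + 1 + 2 * p + 1)) div 2 = int m - p - 1"
    "(int (4 * m) - (int (4 * m) div 2 + 1 + 2 * p - 1)) div 2 = int m - p" "4 * m div 2 = 2 * m"
    by simp_all
  show ?thesis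
    unfolding H_fun_def e G_fun_quotient_power(1)[OF assms, where m = m and q = p, symmetric]
    using G_fun_quotient_power(2,3)[OF assms] power_int_diff[of "G_fun a (1 / w)" "int m - p" 1] by (simp add: mult_ac)
qed

lemma V00_eq:
  assumes a: "0 < a" and w1: "sqrt (2 * c_par a) < cmod w1" "sqrt (2 * c_par a) < 1 / cmod w1"
    and w2: "sqrt (2 * c_par a) < cmod w2" "sqrt (2 * c_par a) < 1 / cmod w2"
  shows "V00 a w1 w2 = Y_sum a (rho a w1) (rho a (1 / w2)) (G_fun a w1) (G_fun a (1 / w2)) /
    (4 * (1 + of_real a ^ 2) ^ 2 * G_fun a w1 * G_fun a (1 / w2)
        * (rho a w1 * rho a (1 / w1)) * (rho a w2 * rho a (1 / w2)))"
proof -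
  have "c_par a > 0" using a by (rule c_par_pos)
  then have k: "sqrt (2 * c_par a) > 0" by simp
  have nz: "w1 \<noteq> 0" "w2 \<noteq> 0" using w1 w2 k by auto
  have s: "s_fun a w1 = rho a w1" "s_fun a (1 / w2) = rho a (1 / w2)"
    using nz by (simp_all add: s_fun_def sqrt_c_inverse_eq[OF a w1(2)] sqrt_c_eq[OF a w2(1)])
  have t: "sqrt_c a w1 * sqrt_c a (1 / w1) = rho a w1 * rho a (1 / w1)"
     "sqrt_c a w2 * sqrt_c a (1 / w2) = rho a w2 * rho a (1 / w2)"
    using nz by (simp_all add: sqrt_c_inverse_eq[OF a w1(2)] sqrt_c_eq[OF a w1(1)]
        sqrt_c_inverse_eq[OF a w2(2)] sqrt_c_eq[OF a w2(1)])
  show ?thesis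
    unfolding V00_def s t
    by (simp add: y_tilde_def Y_sum_def add_divide_distrib diff_divide_distrib)
qed

text \<open>The integrand times -a, with G eliminated in favour of \<open>rho\<close> and grouped so
  that each factor, such as \<open>Y_sum\<close> divided by a, has a finite limit as a tends to
  0.\<close>

definition scaled_integrand :: "real \<Rightarrow> nat \<Rightarrow> int \<Rightarrow> int \<Rightarrow> complex \<times> complex \<Rightarrow> complex" where
  "scaled_integrand a m p q = (\<lambda>(w1, w2).
     w2 / (w2\<^sup>2 - w1\<^sup>2) * (w1 powi (2 * q) / w2 powi (2 * p)) * (w1 / w2)\<^sup>2
     * (D_fun a w1 ^ m / D_fun a w1 powi q / (D_fun a w2 ^ m / D_fun a w2 powi p))
     * ((1 + rho a (1 / w1))\<^sup>2 * (1 + rho a w2)\<^sup>2 / 16)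
     * - (Y_sum a (rho a w1) (rho a (1 / w2))
           (- (of_real (sqrt (2 * c_par a)) / w1) / (1 + rho a (1 / w1)))
           (- (of_real (sqrt (2 * c_par a)) * w2) / (1 + rho a w2)) / of_real a)
     / ((rho a w1 * rho a (1 / w1)) * (rho a w2 * rho a (1 / w2))))"

lemma scaled_integrand_eq:
  assumes a: "0 < a" and w1: "sqrt (2 * c_par a) < cmod w1" "sqrt (2 * c_par a) < 1 / cmod w1"
    and w2: "sqrt (2 * c_par a) < cmod w2" "sqrt (2 * c_par a) < 1 / cmod w2"
  shows "- of_real a * (w2 / (w2\<^sup>2 - w1\<^sup>2)
       * (H_fun a (4 * m) (int (4 * m) div 2 + 1 + 2 * q + 1) (int (4 * m) div 2 + 1 + 2 * q - 1) w1
        / H_fun a (4 * m) (int (4 * m) div 2 + 1 + 2 * p - 1) (int (4 * m) div 2 + 1 + 2 * p + 1) w2)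
       * V00 a w1 w2) = scaled_integrand a m p q (w1, w2)"
proof -
  define g1 where "g1 = G_fun a w1"
  define g2 where "g2 = G_fun a (1 / w2)"
  have c: "c_par a > 0" using a by (rule c_par_pos)
  then have k: "sqrt (2 * c_par a) > 0" by simp
  have nz: "w1 \<noteq> 0" "w2 \<noteq> 0" using w1 w2 k by auto
  have g: "g1 = - (of_real (sqrt (2 * c_par a)) / w1) / (1 + rho a (1 / w1))"
    "g2 = - (of_real (sqrt (2 * c_par a)) * w2) / (1 + rho a w2)"
    unfolding g1_def g2_def by (simp_all only: G_fun_eq[OF a w1(1)] G_fun_inverse_eq[OF a w2(2)])
  define B where "B = 1 + complex_of_real a ^ 2"
  have a2: "B \<noteq> 0"
    unfolding B_def by (metis add_pos_nonneg less_numeral_extra(3) of_real_1 of_real_add of_real_eq_0_iff of_real_power zero_le_power2 zero_less_one)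
  define \<kappa> where "\<kappa> = complex_of_real (sqrt (2 * c_par a))"
  have "\<kappa> * \<kappa> = of_real (2 * c_par a)"
    using c by (simp only: \<kappa>_def of_real_mult[symmetric]) simp
  then have \<kappa>: "\<kappa> * \<kappa> = 2 * of_real a / B"
    by (simp add: c_par_def B_def)
  have "g1 * g2 = (\<kappa> * \<kappa>) * (w2 / w1) / ((1 + rho a (1 / w1)) * (1 + rho a w2))"
    unfolding g \<kappa>_def[symmetric] by (simp add: mult_ac)
  then have "g1 * g2 = (2 * of_real a / B) * (w2 / w1) / ((1 + rho a (1 / w1)) * (1 + rho a w2))"
    unfolding \<kappa> .
  \<comment> \<open>The constant in 4 B^2 (g1 g2)^2 is 4 B^2 (2a / B)^2 = 16 a^2, so B drops out and
    -a / (16 a^2) leaves -(1/a) / 16; the 1/a is then paired with \<open>Y_sum\<close>.\<close>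
  then have gg: "- of_real a * (1 / (4 * B ^ 2 * (g1 * g2)\<^sup>2)) =
     (w1 / w2)\<^sup>2 * ((1 + rho a (1 / w1))\<^sup>2 * (1 + rho a w2)\<^sup>2 / 16) * - (1 / of_real a)"
    using a a2 nz one_plus_rho_neq_0[of a "1 / w1"] one_plus_rho_neq_0[of a w2]
    by (simp add: power_divide power_mult_distrib power2_eq_square mult_ac)
  have alg: "A * (d * (x * e1 / g1 / (y * e2 * g2)) * (Y / (4 * b * g1 * g2 * r1 * r2))) =
     d * (x / y) * (e1 / e2) * (Y / (r1 * r2)) * (A * (1 / (4 * b * (g1 * g2)\<^sup>2)))"
    for A d x e1 y e2 Y b r1 r2 :: complex
    by (simp only: divide_inverse power2_eq_square inverse_mult_distrib mult_ac mult_1_left)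
  show ?thesis
    unfolding H_fun_x_eq[OF a w1] H_fun_y_eq[OF a w2] V00_eq[OF a w1 w2] g1_def[symmetric] g2_def[symmetric] B_def[symmetric]
      alg gg scaled_integrand_def case_prod_conv g[symmetric]
    by (simp only: divide_inverse inverse_mult_distrib mult_minus_left mult_minus_right mult_ac mult_1_left)
qed

section \<open>The discrete Bessel kernel\<close>

lemma contour_integral_circlepath_param:
  "contour_integral (circlepath 0 \<rho>) (\<lambda>w. f w / w) =
     (2 * of_real pi * \<i>) * integral {0..1} (\<lambda>t. f (of_real \<rho> * exp (2 * of_real pi * \<i> * of_real t)))"
  if "\<rho> \<noteq> 0" for \<rho> :: real
proof -
  have "contour_integral (circlepath 0 \<rho>) (\<lambda>w. f w / w) =
      integral {0..1} (\<lambda>t. (2 * of_real pi * \<i>) * f (of_real \<rho> * exp (2 * of_real pi * \<i> * of_real t)))"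
    unfolding contour_integral_integral vector_derivative_circlepath using that
    by (intro integral_cong) (simp add: circlepath)
  then show ?thesis by simp
qed

text \<open>Both sides are the mean of f over a period: doubling runs through two periods at twice
  the speed, the shift only moves the starting point. The shift by 1/2 becomes the sign -1 on the
  circle.\<close>

lemma integral_periodic_double_shift:
  fixes f :: "real \<Rightarrow> complex"
  assumes cont: "continuous_on UNIV f" and per: "\<And>t. f (t + 1) = f t"
  shows "integral {0..1} (\<lambda>t. f (2 * t)) = integral {0..1} (\<lambda>t. f (t + 1/2))"
proof -
  have int: "f integrable_on {a..b}" for a b
    by (intro integrable_continuous_interval continuous_on_subset[OF cont]) auto
  have shift: "integral {c..d} (\<lambda>t. f (t + e)) = integral {c+e..d+e} f" for c d e
    using integral_shift_Icc_real[of c d f e] by (simp add: o_def add.commute)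
  have "((\<lambda>t. f (2 * t + 0)) has_integral (1 / \<bar>2\<bar> ^ DIM(real)) *\<^sub>R integral {0..2} f) ((\<lambda>x. (1/2) *\<^sub>R x + - ((1/2) *\<^sub>R 0)) ` cbox 0 2)"
    using has_integral_affinity[of f "integral {0..2} f" 0 2 2 0] int[of 0 2]
    by (simp add: integrable_integral)
  moreover have "(\<lambda>x. (1/2) *\<^sub>R x + - ((1/2) *\<^sub>R 0)) ` cbox 0 (2::real) = {0..1}"
    by (simp add: image_affinity_cbox)
  ultimately have dbl: "integral {0..1} (\<lambda>t. f (2 * t)) = (1/2) *\<^sub>R integral {0..2} f"
    by (simp add: integral_unique)
  have per1: "integral {c+1..d+1} f = integral {c..d} f" for c d
    using shift[of c d 1] by (simp add: per)
  have "integral {0..2} f = integral {0..1} f + integral {1..2} f"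
    using Henstock_Kurzweil_Integration.integral_combine[where f=f and a=0 and c=1 and b=2] int by simp
  with per1[of 0 1] have "integral {0..2} f = 2 * integral {0..1} f" by simp
  with dbl have "integral {0..1} (\<lambda>t. f (2 * t)) = integral {0..1} f"
    by (simp add: scaleR_conv_of_real)
  moreover have "integral {1/2..3/2} f = integral {1/2..1} f + integral {1..3/2} f"
    using Henstock_Kurzweil_Integration.integral_combine[where f=f and a="1/2" and c=1 and b="3/2"] int by simp
  moreover have "integral {0..1} f = integral {0..1/2} f + integral {1/2..1} f"
    using Henstock_Kurzweil_Integration.integral_combine[where f=f and a=0 and c="1/2" and b=1] int by simp
  ultimately show ?thesis
    using shift[of 0 1 "1/2"] per1[of 0 "1/2"] by simp
qed

text \<open>In the angle parameter, dw / w is 2 pi i dt on a circle of any radius and squaring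
  doubles the angle, so both sides are 2 pi i times the mean of f over the circle of radius
  \<rho>^2.\<close>

lemma contour_integral_circlepath_square:
  fixes \<rho> :: real
  assumes \<rho>: "\<rho> > 0" and cont: "continuous_on (sphere 0 (\<rho>\<^sup>2)) f"
  shows "contour_integral (circlepath 0 \<rho>) (\<lambda>w. f (w\<^sup>2) / w) =
         contour_integral (circlepath 0 (\<rho>\<^sup>2)) (\<lambda>w. f (- w) / w)"
proof -
  define g where "g t = f (of_real (\<rho>\<^sup>2) * exp (2 * of_real pi * \<i> * of_real t))" for t :: real
  have "continuous_on UNIV g"
    unfolding g_def using \<rho>
    by (intro continuous_on_compose2[OF cont] continuous_intros) (auto simp: norm_mult norm_power)
  moreover have "g (t + 1) = g t" for t
    by (simp add: g_def exp_add ring_distribs)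
  ultimately have "integral {0..1} (\<lambda>t. g (2 * t)) = integral {0..1} (\<lambda>t. g (t + 1/2))"
    by (rule integral_periodic_double_shift)
  moreover have "g (2 * t) = f ((of_real \<rho> * exp (2 * of_real pi * \<i> * of_real t))\<^sup>2)" for t
    by (simp add: g_def power_mult_distrib mult_ac flip: exp_of_nat_mult)
  moreover have "g (t + 1/2) = f (- (of_real (\<rho>\<^sup>2) * exp (2 * of_real pi * \<i> * of_real t)))" for t
    by (simp add: g_def exp_add ring_distribs)
  ultimately show ?thesis
    using \<rho> contour_integral_circlepath_param[of \<rho> "\<lambda>w. f (w\<^sup>2)"]
      contour_integral_circlepath_param[of "\<rho>\<^sup>2" "\<lambda>w. f (- w)"]
    by simp
qed

section \<open>Independence of the radii\<close>

lemma contour_integral_circlepath_homotopic: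
  fixes r s :: real
  assumes "open S" "f holomorphic_on S" "0 < r" "r \<le> s"
    and sub: "\<And>z. r \<le> cmod z \<Longrightarrow> cmod z \<le> s \<Longrightarrow> z \<in> S"
  shows "contour_integral (circlepath 0 r) f = contour_integral (circlepath 0 s) f"
proof (rule Cauchy_theorem_homotopic_loops[OF _ assms(1,2)])
  show "homotopic_loops S (circlepath 0 r) (circlepath 0 s)"
  proof (rule homotopic_loops_linear)
    fix t :: real assume "t \<in> {0..1}"
    show "closed_segment (circlepath 0 r t) (circlepath 0 s t) \<subseteq> S"
    proof
      fix z assume "z \<in> closed_segment (circlepath 0 r t) (circlepath 0 s t)"
      then obtain u where u: "0 \<le> u" "u \<le> 1"
        and z: "z = (1 - u) *\<^sub>R circlepath 0 r t + u *\<^sub>R circlepath 0 s t"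
        by (auto simp: in_segment)
      \<comment> \<open>Both circles are taken at the same parameter, so the segment lies on a ray
        and its moduli stay between r and s.\<close>
      have "z = of_real ((1 - u) * r + u * s) * exp (2 * of_real pi * \<i> * of_real t)"
        by (simp add: z circlepath scaleR_conv_of_real algebra_simps)
      moreover have m: "(1 - u) * r + u * s = r + u * (s - r)" by (simp add: algebra_simps)
      ultimately have "cmod z = r + u * (s - r)"
        using assms u by (simp add: norm_mult del: of_real_mult of_real_add)
      moreover have "u * (s - r) \<le> s - r" "0 \<le> u * (s - r)"
        using u assms by (auto simp: mult_left_le_one_le)
      ultimately show "z \<in> S" by (intro sub) auto
    qed
  qed (auto simp: path_circlepath)
qed auto

text \<open>The integral has default value 0, so for a non-integrable f both sides vanish. Constants
  can therefore move through nested integrals without integrability proofs.\<close>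

lemma contour_integral_mult_left:
  "contour_integral \<gamma> (\<lambda>z. c * f z) = c * contour_integral \<gamma> f"
  by (simp add: contour_integral_integral mult.assoc)

lemma contour_integral_circlepath_quotient_radius:
  assumes "h holomorphic_on - {0}" "cmod w < R" "R \<le> R'"
  shows "contour_integral (circlepath 0 R) (\<lambda>z. h z / (z - w)) =
         contour_integral (circlepath 0 R') (\<lambda>z. h z / (z - w))"
proof (rule contour_integral_circlepath_homotopic)
  show "open {z. cmod w < cmod z}"
    by (intro open_Collect_less continuous_intros)
  show "(\<lambda>z. h z / (z - w)) holomorphic_on {z. cmod w < cmod z}"
    by (intro holomorphic_intros holomorphic_on_subset[OF assms(1)]) auto
  show "0 < R" using assms(2) norm_ge_zero[of w] by linarith
qed (use assms in auto)

lemma holomorphic_on_circlepath_Cauchy_transform: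
  assumes "continuous_on (sphere 0 R) h" "R > 0"
  shows "(\<lambda>w. contour_integral (circlepath 0 R) (\<lambda>z. h z / (z - w))) holomorphic_on ball 0 R"
proof -
  have "((\<lambda>z. h z / (z - w) ^ 1) has_contour_integral
          contour_integral (circlepath 0 R) (\<lambda>z. h z / (z - w))) (circlepath 0 R)"
    if "w \<in> ball 0 R" for w
    using that assms
    by (intro has_contour_integral_integral[THEN has_contour_integral_eq]
          contour_integrable_continuous_circlepath continuous_intros) auto
  then have "\<exists>d. ((\<lambda>w. contour_integral (circlepath 0 R) (\<lambda>z. h z / (z - w))) has_field_derivative d) (at w)"
    if "w \<in> ball 0 R" for w
    using Cauchy_next_derivative_circlepath(2)[of 0 R h 1] assms that by fastforce
  then show ?thesis
    by (simp add: holomorphic_on_open)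
qed

text \<open>Moving the circles directly from one pair of radii to the other could make them cross,
  and z = w is a pole. Both z-circles are therefore enlarged to the common radius S = max R R',
  inside which the w-circle is free to move.\<close>

lemma double_contour_integral_radii:
  fixes g h :: "complex \<Rightarrow> complex"
  assumes g: "g holomorphic_on - {0}" and h: "h holomorphic_on - {0}"
    and "0 < \<rho>" "\<rho> < R" "0 < \<rho>'" "\<rho>' < R'"
  shows "contour_integral (circlepath 0 \<rho>) (\<lambda>w. g w * contour_integral (circlepath 0 R) (\<lambda>z. h z / (z - w))) =
         contour_integral (circlepath 0 \<rho>') (\<lambda>w. g w * contour_integral (circlepath 0 R') (\<lambda>z. h z / (z - w)))"
    (is "?J \<rho> R = ?J \<rho>' R'")
proof -
  have outer: "?J \<sigma> S = ?J \<sigma>' S" if "0 < \<sigma>" "\<sigma> \<le> \<sigma>'" "\<sigma>' < S" for \<sigma> \<sigma>' S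
  proof (rule contour_integral_circlepath_homotopic)
    show "open (ball 0 S - {0::complex})" by auto
    have "continuous_on (sphere 0 S) h"
      using that by (intro holomorphic_on_imp_continuous_on holomorphic_on_subset[OF h]) auto
    then have "(\<lambda>w. contour_integral (circlepath 0 S) (\<lambda>z. h z / (z - w))) holomorphic_on ball 0 S"
      using that by (intro holomorphic_on_circlepath_Cauchy_transform) auto
    then show "(\<lambda>w. g w * contour_integral (circlepath 0 S) (\<lambda>z. h z / (z - w))) holomorphic_on ball 0 S - {0}"
      by (intro holomorphic_intros holomorphic_on_subset[OF g]) (auto elim: holomorphic_on_subset)
  qed (use that in auto)
  have inner: "?J \<sigma> S = ?J \<sigma> S'" if "0 < \<sigma>" "\<sigma> < S" "S \<le> S'" for \<sigma> S S'
    using that contour_integral_circlepath_quotient_radius[OF h, of _ S S']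
    by (intro contour_integral_eq) auto
  define S where "S = max R R'"
  have "?J \<rho> R = ?J \<rho> S" "?J \<rho>' R' = ?J \<rho>' S"
    using assms by (auto simp: S_def intro!: inner)
  moreover have "?J \<rho> S = ?J \<rho>' S"
  proof (cases "\<rho> \<le> \<rho>'")
    case True
    then show ?thesis using assms by (intro outer) (auto simp: S_def)
  next
    case False
    then show ?thesis using assms by (intro outer [symmetric]) (auto simp: S_def)
  qed
  ultimately show ?thesis by simp
qed

section \<open>Identification with the Bessel kernel\<close>

lemma power_int_quotient_minus:
  fixes x z :: complex
  assumes "x \<noteq> 0" "z \<noteq> 0"
  shows "x powi (q + 1) / (- z) powi (p + 1) = - ((-1) powi (p - q)) * x * (- x) powi q / z powi (p + 1)"
  \<comment> \<open>The sign is (-1)^q from x^q, times (-1)^(p + 1) from the denominator; its parity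
    is that of p - q + 1.\<close>
  using assms by (cases "even p"; cases "even q") (simp_all add: power_int_minus_left power_int_add_1)

lemma B00_limit_eq_K_Bessel:
  fixes p q :: int
  assumes r: "0 < r" "r < 1" and \<nu>: "\<nu> \<ge> 0" and radii: "0 < \<rho>" "\<rho> < R"
  shows "B00_limit \<nu> r (2 * p) (2 * q) =
     (-1) powi (p - q) * K_Bessel R \<rho> ((of_int (2 * p) + 1) / 2) ((of_int (2 * q) + 1) / 2) ((\<nu> / 2)\<^sup>2)"
proof -
  define s :: complex where "s = of_real (\<nu> / 2)"
  define g where "g w = exp (s * (1 / w - w)) * w powi q" for w
  define h where "h z = exp (s * (z - 1 / z)) / z powi (p + 1)" for z
  define \<epsilon> :: complex where "\<epsilon> = (-1) powi (p - q)"
  define \<Phi> where "\<Phi> w = contour_integral (circlepath 0 ((1 / r)\<^sup>2)) (\<lambda>z. h z / (z - w))" for w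
  \<comment> \<open>Chosen so that the inner integral is F at w1^2, while at -w the leading factor
    cancels the weight: F(-w) / w = \<epsilon> * g w * \<Phi> w.\<close>
  define F where "F \<omega> = - \<omega> * (\<epsilon> * g (- \<omega>) * \<Phi> (- \<omega>))" for \<omega>
  have r2: "0 < r\<^sup>2" "r\<^sup>2 < 1" "1 < (1 / r)\<^sup>2"
    using r by (auto simp: power_less_one_iff one_less_power)
  have g_holo: "g holomorphic_on - {0}" and h_holo: "h holomorphic_on - {0}"
    unfolding g_def h_def by (auto intro!: holomorphic_intros)
  have h_cont: "continuous_on (sphere 0 ((1 / r)\<^sup>2)) h"
    using r2 by (intro holomorphic_on_imp_continuous_on holomorphic_on_subset[OF h_holo]) auto
  have "\<Phi> holomorphic_on ball 0 ((1 / r)\<^sup>2)"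
    unfolding \<Phi>_def using r2 h_cont by (intro holomorphic_on_circlepath_Cauchy_transform) auto
  then have "continuous_on (ball 0 ((1 / r)\<^sup>2)) \<Phi>"
    by (rule holomorphic_on_imp_continuous_on)
  then have "continuous_on (sphere 0 (r\<^sup>2)) (\<lambda>\<omega>. \<Phi> (- \<omega>))"
    using r2 by (elim continuous_on_compose2) (auto intro: continuous_intros)
  moreover have "continuous_on (sphere 0 (r\<^sup>2)) (\<lambda>\<omega>. g (- \<omega>))"
    using r2 by (intro continuous_on_compose2[OF holomorphic_on_imp_continuous_on[OF g_holo]] continuous_intros) auto
  ultimately have F_cont: "continuous_on (sphere 0 (r\<^sup>2)) F"
    unfolding F_def by (intro continuous_on_mult continuous_on_minus continuous_on_const continuous_on_id)

  have inner: "contour_integral (circlepath 0 (1 / r)) (\<lambda>w2.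
         w2 / (w2\<^sup>2 - w1\<^sup>2)
         * (exp (of_real (\<nu> / 2) * (w1\<^sup>2 - 1 / w1\<^sup>2) + of_int (2 * q) * Ln w1)
            / exp (of_real (\<nu> / 2) * (w2\<^sup>2 - 1 / w2\<^sup>2) + of_int (2 * p) * Ln w2))
         * (w1 / w2)\<^sup>2) = F (w1\<^sup>2)" (is "contour_integral _ ?I = _") if w1: "cmod w1 = r" for w1
  proof -
    \<comment> \<open>The exponents q + 1 and p + 1 absorb (w1 / w2)^2. Writing the remaining w2 as
      w2^2 / w2 makes f a function of w2^2 and leaves the weight 1 / w2.\<close>
    define f where "f \<zeta> = \<zeta> / (\<zeta> - w1\<^sup>2) * (exp (s * (w1\<^sup>2 - 1 / w1\<^sup>2)) * (w1\<^sup>2) powi (q + 1))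
       / (exp (s * (\<zeta> - 1 / \<zeta>)) * \<zeta> powi (p + 1))" for \<zeta>
    have w1_nz: "w1 \<noteq> 0" using w1 r by auto
    have n: "cmod (w1\<^sup>2) = r\<^sup>2" using w1 by (simp add: norm_power)
    \<comment> \<open>The exponent is an even integer: being an integer, it hides the branch of Ln;
      being even, it gives a function of w^2.\<close>
    have exp_Ln: "exp (of_int (2 * k) * Ln w) = (w\<^sup>2) powi k" if "w \<noteq> 0" for w k
    proof -
      have "exp (of_int (2 * k) * Ln w) = w powi (2 * k)"
        using that exp_power_int[of "Ln w" "2 * k"] by simp
      then show ?thesis by (simp add: power_int_mult)
    qed
    have nz: "\<zeta> \<noteq> 0" "\<zeta> - w1\<^sup>2 \<noteq> 0" "exp (s * (\<zeta> - 1 / \<zeta>)) * \<zeta> powi (p + 1) \<noteq> 0"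
      if "\<zeta> \<in> sphere 0 ((1 / r)\<^sup>2)" for \<zeta>
      using that r2 n by auto
    have alg: "w2 / d * (e * x / (e' * y)) * (w1 / w2)\<^sup>2 =
        w2\<^sup>2 / d * (e * (x * w1\<^sup>2)) / (e' * (y * w2\<^sup>2)) / w2" if "w2 \<noteq> 0" for w2 d e e' x y
      using that by (simp add: divide_inverse power2_eq_square mult_ac)
    have "contour_integral (circlepath 0 (1 / r)) ?I = contour_integral (circlepath 0 (1 / r)) (\<lambda>w2. f (w2\<^sup>2) / w2)"
    proof (rule contour_integral_eq)
      fix w2 assume "w2 \<in> path_image (circlepath 0 (1 / r))"
      then have w2: "w2 \<noteq> 0" using r by auto
      show "?I w2 = f (w2\<^sup>2) / w2"
        using w2 w1_nz unfolding f_def s_def exp_add exp_Ln[OF w2] exp_Ln[OF w1_nz]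
        by (subst alg) (auto simp: power_int_add)
    qed
    also have "\<dots> = contour_integral (circlepath 0 ((1 / r)\<^sup>2)) (\<lambda>z. f (- z) / z)"
    proof (rule contour_integral_circlepath_square)
      show "continuous_on (sphere 0 ((1 / r)\<^sup>2)) f"
        unfolding f_def using nz by (intro continuous_intros) blast+
    qed (use r in auto)
    also have "\<dots> = contour_integral (circlepath 0 ((1 / r)\<^sup>2)) (\<lambda>z. (w1\<^sup>2 * - \<epsilon> * g (- w1\<^sup>2)) * (h z / (z - - w1\<^sup>2)))"
    proof (rule contour_integral_eq)
      fix z assume "z \<in> path_image (circlepath 0 ((1 / r)\<^sup>2))"
      then have z: "cmod z = (1 / r)\<^sup>2" using r by auto
      then have z_nz: "z \<noteq> 0" "z + w1\<^sup>2 \<noteq> 0"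
        using r2 n by (auto dest!: arg_cong[where f = cmod] simp: add_eq_0_iff2)
      have minus_z: "- z - w1\<^sup>2 \<noteq> 0"
        using z_nz by (metis minus_add_distrib diff_conv_add_uminus neg_equal_0_iff_equal)
      have sgn: "(w1\<^sup>2) powi (q + 1) / (- z) powi (p + 1) = - \<epsilon> * w1\<^sup>2 * (- w1\<^sup>2) powi q / z powi (p + 1)"
        unfolding \<epsilon>_def using w1_nz z_nz by (intro power_int_quotient_minus) auto
      have e: "exp (s * (- z - 1 / - z)) = inverse (exp (s * (z - 1 / z)))"
        by (simp add: algebra_simps flip: exp_minus)
      have e': "exp (s * (w1\<^sup>2 - 1 / w1\<^sup>2)) = exp (s * (1 / - w1\<^sup>2 - - w1\<^sup>2))"
        by (simp add: algebra_simps)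
      have "f (- z) / z = (- z) / (- z - w1\<^sup>2) / z * exp (s * (w1\<^sup>2 - 1 / w1\<^sup>2)) / exp (s * (- z - 1 / - z))
          * ((w1\<^sup>2) powi (q + 1) / (- z) powi (p + 1))"
        by (simp add: f_def)
      also have "(- z) / (- z - w1\<^sup>2) / z = 1 / (z - - w1\<^sup>2)"
        using z_nz minus_z by (simp add: divide_simps)
      finally show "f (- z) / z = (w1\<^sup>2 * - \<epsilon> * g (- w1\<^sup>2)) * (h z / (z - - w1\<^sup>2))"
        unfolding sgn e e' by (simp add: g_def h_def divide_inverse mult_ac)
    qed
    also have "\<dots> = F (w1\<^sup>2)"
      unfolding F_def \<Phi>_def contour_integral_mult_left by simp
    finally show ?thesis .
  qed
  have "B00_limit \<nu> r (2 * p) (2 * q) = 1 / (2 * of_real pi * \<i>)\<^sup>2 *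
     contour_integral (circlepath 0 r) (\<lambda>w1. F (w1\<^sup>2) / w1)"
    unfolding B00_limit_def using r inner
    by (intro arg_cong2[where f = "(*)"] contour_integral_eq refl) auto
  also have "contour_integral (circlepath 0 r) (\<lambda>w1. F (w1\<^sup>2) / w1) =
      contour_integral (circlepath 0 (r\<^sup>2)) (\<lambda>w. F (- w) / w)"
    using F_cont r by (intro contour_integral_circlepath_square)
  also have "\<dots> = contour_integral (circlepath 0 (r\<^sup>2)) (\<lambda>w. (\<epsilon> * g w) * \<Phi> w)"
    using r by (intro contour_integral_eq) (auto simp: F_def)
  also have "\<dots> = contour_integral (circlepath 0 \<rho>) (\<lambda>w. (\<epsilon> * g w) * contour_integral (circlepath 0 R) (\<lambda>z. h z / (z - w)))"
    unfolding \<Phi>_def using r2 radii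
    by (intro double_contour_integral_radii h_holo holomorphic_intros g_holo) auto
  also have "\<dots> = \<epsilon> * contour_integral (circlepath 0 \<rho>) (\<lambda>w. g w * contour_integral (circlepath 0 R) (\<lambda>z. h z / (z - w)))"
    by (simp only: contour_integral_mult_left mult.assoc)
  also have "contour_integral (circlepath 0 \<rho>) (\<lambda>w. g w * contour_integral (circlepath 0 R) (\<lambda>z. h z / (z - w))) =
     contour_integral (circlepath 0 \<rho>) (\<lambda>w.
       contour_integral (circlepath 0 R) (\<lambda>z.
         exp (of_real (sqrt ((\<nu> / 2)\<^sup>2)) * (z - 1 / z - w + 1 / w)) / (z - w)
         * (1 / (z powr of_real ((of_int (2 * p) + 1) / 2 + 1/2) * w powr of_real (- ((of_int (2 * q) + 1) / 2) + 1/2)))))"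
    unfolding contour_integral_mult_left [symmetric]
  proof (intro contour_integral_eq)
    fix w z assume "w \<in> path_image (circlepath 0 \<rho>)" "z \<in> path_image (circlepath 0 R)"
    then have nz: "w \<noteq> 0" "z \<noteq> 0" using radii by auto
    \<comment> \<open>At half-integer points both exponents are integers, so \<open>powr\<close> is
      an integer power and has no jump on the circles.\<close>
    have "(of_int (2 * p) + 1) / 2 + 1/2 = real_of_int (p + 1)" "- ((of_int (2 * q) + 1) / 2) + 1/2 = real_of_int (- q)"
      by (simp_all add: field_simps)
    then have pw: "z powr of_real ((of_int (2 * p) + 1) / 2 + 1/2) = z powi (p + 1)"
       "w powr of_real (- ((of_int (2 * q) + 1) / 2) + 1/2) = w powi (- q)"
      using nz by (simp_all only: of_real_of_int_eq complex_powr_of_int simp_thms)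
    have e: "exp (s * (z - 1 / z - w + 1 / w)) = exp (s * (1 / w - w)) * exp (s * (z - 1 / z))"
      by (simp add: algebra_simps flip: exp_add)
    have s: "complex_of_real (sqrt ((\<nu> / 2)\<^sup>2)) = s"
      using \<nu> by (simp add: s_def)
    show "g w * (h z / (z - w)) =
       exp (of_real (sqrt ((\<nu> / 2)\<^sup>2)) * (z - 1 / z - w + 1 / w)) / (z - w)
         * (1 / (z powr of_real ((of_int (2 * p) + 1) / 2 + 1/2) * w powr of_real (- ((of_int (2 * q) + 1) / 2) + 1/2)))"
      unfolding pw s e g_def h_def power_int_minus
      by (simp only: divide_inverse inverse_mult_distrib inverse_inverse_eq mult_1_left mult_ac)
  qed
  finally show ?thesis
    unfolding K_Bessel_def \<epsilon>_def by (simp only: mult.left_commute[of "1 / _"])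
qed

section \<open>The limit of the rescaled integrals\<close>

text \<open>The integrand of \<open>B00_limit\<close> with Ln replaced by integer powers, which
  makes its continuity on the torus visible; the factors follow the order of
  \<open>scaled_integrand\<close>.\<close>

definition limit_integrand :: "real \<Rightarrow> int \<Rightarrow> int \<Rightarrow> complex \<times> complex \<Rightarrow> complex" where
  "limit_integrand \<nu> p q = (\<lambda>(w1, w2).
     w2 / (w2\<^sup>2 - w1\<^sup>2) * (w1 powi (2 * q) / w2 powi (2 * p)) * (w1 / w2)\<^sup>2
     * (exp (of_real (\<nu> / 2) * (w1\<^sup>2 - 1 / w1\<^sup>2)) / exp (of_real (\<nu> / 2) * (w2\<^sup>2 - 1 / w2\<^sup>2))))"

lemma tendsto_scaled_integrand:
  fixes N :: "'a \<Rightarrow> nat"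
  assumes A: "(A \<longlongrightarrow> 0) F" and nz: "\<forall>\<^sub>F x in F. A x \<noteq> 0"
    and NA: "((\<lambda>x. real (N x) * A x) \<longlongrightarrow> \<nu>) F"
    and W: "(W1 \<longlongrightarrow> w1) F" "(W2 \<longlongrightarrow> w2) F"
    and w: "w1 \<noteq> 0" "w2 \<noteq> 0" "w2\<^sup>2 \<noteq> w1\<^sup>2"
  shows "((\<lambda>x. scaled_integrand (A x) (N x) p q (W1 x, W2 x)) \<longlongrightarrow> limit_integrand \<nu> p q (w1, w2)) F"
proof -
  have W': "((\<lambda>x. 1 / W1 x) \<longlongrightarrow> 1 / w1) F" "((\<lambda>x. 1 / W2 x) \<longlongrightarrow> 1 / w2) F"
    using w by (auto intro!: tendsto_intros W)
  note rho = tendsto_rho[OF A W(1)] tendsto_rho[OF A W'(1)] tendsto_rho[OF A W(2)] tendsto_rho[OF A W'(2)]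
  note D = tendsto_D_fun[OF A W(1) w(1)] tendsto_D_fun[OF A W(2) w(2)]
  note DN = tendsto_D_fun_power[OF A W(1) w(1) NA] tendsto_D_fun_power[OF A W(2) w(2) NA]
  have k: "((\<lambda>x. complex_of_real (sqrt (2 * c_par (A x)))) \<longlongrightarrow> 0) F"
    using tendsto_of_real[OF tendsto_real_sqrt[OF tendsto_mult[OF tendsto_const[of 2] tendsto_c_par[OF A]]]]
    by simp
  have "((\<lambda>x. - (of_real (sqrt (2 * c_par (A x))) / W1 x) / (1 + rho (A x) (1 / W1 x))) \<longlongrightarrow> - (0 / w1) / (1 + 1)) F"
    "((\<lambda>x. - (of_real (sqrt (2 * c_par (A x))) * W2 x) / (1 + rho (A x) (W2 x))) \<longlongrightarrow> - (0 * w2) / (1 + 1)) F"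
    by (intro tendsto_divide tendsto_minus tendsto_mult tendsto_add tendsto_const k W rho; use w in simp)+
  then have Y: "((\<lambda>x. Y_sum (A x) (rho (A x) (W1 x)) (rho (A x) (1 / W2 x))
           (- (of_real (sqrt (2 * c_par (A x))) / W1 x) / (1 + rho (A x) (1 / W1 x)))
           (- (of_real (sqrt (2 * c_par (A x))) * W2 x) / (1 + rho (A x) (W2 x))) / of_real (A x)) \<longlongrightarrow> -1) F"
    by (intro tendsto_Y_sum A nz rho) simp_all
  let ?E = "\<lambda>w. exp (of_real (\<nu> / 2) * (w\<^sup>2 - 1 / w\<^sup>2)) :: complex"
  \<comment> \<open>The limit is written in the shape of \<open>scaled_integrand\<close> so that the
    limit rules match factor by factor. The constants (2^2 * 2^2) / 16 and -(-1) are both 1.\<close>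
  have "((\<lambda>x. scaled_integrand (A x) (N x) p q (W1 x, W2 x)) \<longlongrightarrow>
     w2 / (w2\<^sup>2 - w1\<^sup>2) * (w1 powi (2 * q) / w2 powi (2 * p)) * (w1 / w2)\<^sup>2
     * (?E w1 / 1 powi q / (?E w2 / 1 powi p)) * ((1 + 1)\<^sup>2 * (1 + 1)\<^sup>2 / 16) * - (- 1) / ((1 * 1) * (1 * 1))) F"
    unfolding scaled_integrand_def case_prod_conv
    by (intro tendsto_divide tendsto_mult tendsto_minus tendsto_power tendsto_power_int tendsto_add tendsto_diff
        tendsto_const Y rho D DN W) (use w in auto)
  then show ?thesis by (simp add: limit_integrand_def)
qed

text \<open>The radicand is 1 + u with |u| < 1, hence in the open right half-plane, away from 0 and
  from the cut of the principal root.\<close>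

lemma continuous_on_rho:
  assumes f: "continuous_on S f" and a: "0 < a" and b: "\<And>x. x \<in> S \<Longrightarrow> sqrt (2 * c_par a) * cmod (f x) < 1"
  shows "continuous_on S (\<lambda>x. rho a (f x))" and "\<And>x. x \<in> S \<Longrightarrow> rho a (f x) \<noteq> 0"
proof -
  have c: "c_par a > 0" using a by (rule c_par_pos)
  have small: "cmod (of_real (2 * c_par a) * (f x)\<^sup>2) < 1" if "x \<in> S" for x
  proof -
    have "cmod (of_real (2 * c_par a) * (f x)\<^sup>2) = (sqrt (2 * c_par a) * cmod (f x))\<^sup>2"
      using c by (simp add: norm_mult norm_power power_mult_distrib)
    also have "\<dots> < 1"
      using b[OF that] c by (simp add: power_less_one_iff)
    finally show ?thesis .
  qed
  have nonpos: "1 + u \<notin> \<real>\<^sub>\<le>\<^sub>0" if "cmod u < 1" for u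
    using that abs_Re_le_cmod[of u] by (auto simp: complex_nonpos_Reals_iff)
  show "continuous_on S (\<lambda>x. rho a (f x))"
    unfolding rho_def using nonpos[OF small]
    by (intro continuous_on_compose2[OF continuous_on_csqrt] continuous_intros f) auto
  show "rho a (f x) \<noteq> 0" if "x \<in> S" for x
    using nonpos[OF small[OF that]] unfolding rho_def by (auto simp del: of_real_mult)
qed

lemma continuous_on_scaled_integrand:
  assumes a: "0 < a" and r: "sqrt (2 * c_par a) < r" "r < 1"
  shows "continuous_on (sphere 0 r \<times> sphere 0 (1 / r)) (scaled_integrand a m p q)"
proof -
  let ?T = "sphere (0::complex) r \<times> sphere (0::complex) (1 / r)"
  have "c_par a > 0" using a by (rule c_par_pos)
  then have r0: "r > 0" using r by (smt (verit) real_sqrt_ge_zero)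
  have w: "fst x \<noteq> 0" "snd x \<noteq> 0" "(snd x)\<^sup>2 - (fst x)\<^sup>2 \<noteq> 0" if "x \<in> ?T" for x
  proof -
    have "cmod ((fst x)\<^sup>2) < 1" "1 < cmod ((snd x)\<^sup>2)"
      using that r r0 by (auto simp: norm_power power_less_one_iff one_less_power)
    then show "(snd x)\<^sup>2 - (fst x)\<^sup>2 \<noteq> 0" by auto
  qed (use that r0 in auto)
  \<comment> \<open>On the torus every argument of \<open>rho\<close>, whether w or 1/w, has modulus
    r or 1/r; sqrt (2c) < r < 1 handles both.\<close>
  have b: "sqrt (2 * c_par a) * t < 1" if "t = r \<or> t = 1 / r" for t
  proof -
    have "sqrt (2 * c_par a) * t < r * t" using that r r0 by (intro mult_strict_right_mono) auto
    also have "r * t \<le> 1" using that r r0 by (auto simp: mult_le_one)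
    finally show ?thesis .
  qed
  have rho_gen: "continuous_on ?T (\<lambda>x. rho a (f x))" "\<And>x. x \<in> ?T \<Longrightarrow> rho a (f x) \<noteq> 0"
    if "continuous_on ?T f" "\<And>x. x \<in> ?T \<Longrightarrow> cmod (f x) = r \<or> cmod (f x) = 1 / r" for f
    using continuous_on_rho[OF that(1) a] that(2) b by blast+
  have circles: "cmod (fst x) = r" "cmod (1 / fst x) = 1 / r" "cmod (snd x) = 1 / r" "cmod (1 / snd x) = r"
    if "x \<in> ?T" for x
    using that by (auto simp: norm_divide)
  have inv: "continuous_on ?T (\<lambda>x. 1 / fst x)" "continuous_on ?T (\<lambda>x. 1 / snd x)"
    using w by (auto intro!: continuous_intros)
  have rho: "continuous_on ?T (\<lambda>x. rho a (fst x))" "continuous_on ?T (\<lambda>x. rho a (1 / fst x))"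
    "continuous_on ?T (\<lambda>x. rho a (snd x))" "continuous_on ?T (\<lambda>x. rho a (1 / snd x))"
    by (rule rho_gen; (intro inv continuous_intros)?; use circles in blast)+
  have rho0: "rho a (fst x) \<noteq> 0" "rho a (1 / fst x) \<noteq> 0" "rho a (snd x) \<noteq> 0" "rho a (1 / snd x) \<noteq> 0"
    if "x \<in> ?T" for x
    by (rule rho_gen(2)[OF _ _ that]; (intro inv continuous_intros)?; use circles in blast)+
  have D: "continuous_on ?T (\<lambda>x. D_fun a (fst x))" "continuous_on ?T (\<lambda>x. D_fun a (snd x))"
    unfolding D_fun_def by (auto intro!: continuous_intros rho simp: one_plus_rho_neq_0)
  have D0: "D_fun a x \<noteq> 0" for x
    by (simp add: D_fun_def one_plus_rho_neq_0)
  have y: "continuous_on S (\<lambda>x. y00 c (f x) (g x))" "continuous_on S (\<lambda>x. y01 c (f x) (g x))"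
    "continuous_on S (\<lambda>x. y10 c (f x) (g x))" "continuous_on S (\<lambda>x. y11 c (f x) (g x))"
    if "continuous_on S f" "continuous_on S g" for c f g and S :: "(complex \<times> complex) set"
    unfolding y00_def y01_def y10_def y11_def
    by (intro continuous_on_mult continuous_on_add continuous_on_diff continuous_on_power continuous_on_const that)+
  show ?thesis
    unfolding scaled_integrand_def case_prod_unfold Y_sum_def
    by (intro continuous_intros rho D y) (use w rho0 D0 one_plus_rho_neq_0 a in auto)
qed

lemma scaled_B00_eq:
  assumes a: "0 < a" and r: "sqrt (2 * c_par a) < r" "r < 1"
  shows "- of_real a * \<i> * B00 r (4 * m) a (x_vertex (4 * m) (2 * q)) (y_vertex (4 * m) (2 * p)) =
    1 / (2 * of_real pi * \<i>)\<^sup>2 * contour_integral (circlepath 0 r) (\<lambda>w1. 1 / w1 *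
       contour_integral (circlepath 0 (1 / r)) (\<lambda>w2. scaled_integrand a m p q (w1, w2)))"
proof -
  have "c_par a > 0" using a by (rule c_par_pos)
  then have r0: "r > 0" using r by (smt (verit) real_sqrt_ge_zero)
  then have kr: "sqrt (2 * c_par a) < 1 / r" using r by (smt (verit) less_divide_eq_1_pos)
  define f where "f w1 w2 = w2 / (w2\<^sup>2 - w1\<^sup>2)
       * (H_fun a (4 * m) (int (4 * m) div 2 + 1 + 2 * q + 1) (int (4 * m) div 2 + 1 + 2 * q - 1) w1
        / H_fun a (4 * m) (int (4 * m) div 2 + 1 + 2 * p - 1) (int (4 * m) div 2 + 1 + 2 * p + 1) w2)
       * V00 a w1 w2" for w1 w2
  define I where "I g = contour_integral (circlepath 0 r) (\<lambda>w1. 1 / w1 *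
       contour_integral (circlepath 0 (1 / r)) (\<lambda>w2. g w1 w2))" for g :: "complex \<Rightarrow> complex \<Rightarrow> complex"
  \<comment> \<open>For these vertices x2 - x1 + y1 - y2 = -2, so the prefactor is 1/i and cancels
    the i in -a i.\<close>
  have e: "(int (4 * m) div 2 + 1 + 2 * q - 1 - (int (4 * m) div 2 + 1 + 2 * q) +
       (int (4 * m) div 2 + 1 + 2 * p - 1) - (int (4 * m) div 2 + 1 + 2 * p)) div 2 = - 1"
    by simp
  have "B00 r (4 * m) a (x_vertex (4 * m) (2 * q)) (y_vertex (4 * m) (2 * p)) =
      \<i> powi (- 1) / (2 * of_real pi * \<i>)\<^sup>2 * I f"
    unfolding B00_def x_vertex_def y_vertex_def case_prod_conv e I_def f_def ..
  then have "- of_real a * \<i> * B00 r (4 * m) a (x_vertex (4 * m) (2 * q)) (y_vertex (4 * m) (2 * p)) =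
      1 / (2 * of_real pi * \<i>)\<^sup>2 * (- of_real a * I f)"
  proof -
    have "- A * \<i> * (\<i> powi (- 1) / C * X) = (\<i> * \<i> powi (- 1)) * (1 / C * (- A * X))" for A C X
      by (simp only: divide_inverse mult_minus_left mult_minus_right mult_ac mult_1_left)
    then show ?thesis by (simp add: \<open>B00 _ _ _ _ _ = _\<close> power_int_minus)
  qed
  also have "- of_real a * I f = I (\<lambda>w1 w2. - of_real a * f w1 w2)"
    unfolding I_def contour_integral_mult_left
    by (subst contour_integral_mult_left[symmetric]) (simp only: mult_ac)
  also have "\<dots> = I (\<lambda>w1 w2. scaled_integrand a m p q (w1, w2))"
    unfolding I_def f_def using r0 r kr
    by (intro contour_integral_eq arg_cong2[where f = "(*)"] refl scaled_integrand_eq a) auto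
  finally show ?thesis unfolding I_def .
qed

lemma B00_limit_eq:
  assumes r: "0 < r"
  shows "B00_limit \<nu> r (2 * p) (2 * q) =
    1 / (2 * of_real pi * \<i>)\<^sup>2 * contour_integral (circlepath 0 r) (\<lambda>w1. 1 / w1 *
       contour_integral (circlepath 0 (1 / r)) (\<lambda>w2. limit_integrand \<nu> p q (w1, w2)))"
proof -
  have e: "exp (of_int n * Ln w) = w powi n" if "w \<noteq> 0" for n w
    using that exp_power_int[of "Ln w" n] by simp
  have "contour_integral (circlepath 0 r) (\<lambda>w1. 1 / w1 *
       contour_integral (circlepath 0 (1 / r)) (\<lambda>w2.
         w2 / (w2\<^sup>2 - w1\<^sup>2)
         * (exp (of_real (\<nu> / 2) * (w1\<^sup>2 - 1 / w1\<^sup>2) + of_int (2 * q) * Ln w1)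
            / exp (of_real (\<nu> / 2) * (w2\<^sup>2 - 1 / w2\<^sup>2) + of_int (2 * p) * Ln w2))
         * (w1 / w2)\<^sup>2)) = contour_integral (circlepath 0 r) (\<lambda>w1. 1 / w1 *
       contour_integral (circlepath 0 (1 / r)) (\<lambda>w2. limit_integrand \<nu> p q (w1, w2)))"
  proof (rule contour_integral_eq, rule arg_cong[where f = "(*) _"], rule contour_integral_eq)
    fix w1 w2 assume "w1 \<in> path_image (circlepath 0 r)" "w2 \<in> path_image (circlepath 0 (1 / r))"
    then have nz: "w1 \<noteq> 0" "w2 \<noteq> 0" using r by auto
    show "w2 / (w2\<^sup>2 - w1\<^sup>2)
         * (exp (of_real (\<nu> / 2) * (w1\<^sup>2 - 1 / w1\<^sup>2) + of_int (2 * q) * Ln w1)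
            / exp (of_real (\<nu> / 2) * (w2\<^sup>2 - 1 / w2\<^sup>2) + of_int (2 * p) * Ln w2))
         * (w1 / w2)\<^sup>2 = limit_integrand \<nu> p q (w1, w2)"
      unfolding limit_integrand_def case_prod_conv exp_add e[OF nz(1)] e[OF nz(2)]
      by (simp only: divide_inverse inverse_mult_distrib mult_ac)
  qed
  then show ?thesis
    unfolding B00_limit_def by (rule arg_cong)
qed

lemma scaled_B00_tendsto:
  fixes a :: "nat \<Rightarrow> real"
  assumes a_pos: "\<forall>\<^sub>F m in sequentially. a m > 0"
    and a_lim: "(\<lambda>m. real m * a m) \<longlonglongrightarrow> \<nu>"
    and r: "0 < r" "r < 1"
  shows "(\<lambda>m. - of_real (a m) * \<i> * B00 r (4 * m) (a m) (x_vertex (4 * m) (2 * q)) (y_vertex (4 * m) (2 * p)))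
     \<longlonglongrightarrow> B00_limit \<nu> r (2 * p) (2 * q)"
proof -
  let ?T = "sphere (0::complex) r \<times> sphere (0::complex) (1 / r)"
  \<comment> \<open>The scaling m * a \<rightarrow> \<nu> forces a to 0, and hence sqrt (2c) < r
    eventually, although r is fixed in advance.\<close>
  have "(\<lambda>m. real m * a m * (1 / real m)) \<longlonglongrightarrow> \<nu> * 0"
    by (intro tendsto_mult a_lim lim_1_over_n)
  moreover have "\<forall>\<^sub>F m in sequentially. real m * a m * (1 / real m) = a m"
    using eventually_gt_at_top[of 0] by eventually_elim simp
  ultimately have a0: "a \<longlonglongrightarrow> 0"
    using Lim_transform_eventually by force
  have "(\<lambda>m. sqrt (2 * c_par (a m))) \<longlonglongrightarrow> sqrt (2 * 0)"
    by (intro tendsto_intros tendsto_c_par a0)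
  then have "\<forall>\<^sub>F m in sequentially. sqrt (2 * c_par (a m)) < r"
    using r by (intro order_tendstoD) auto
  with a_pos have ev: "\<forall>\<^sub>F m in sequentially. 0 < a m \<and> sqrt (2 * c_par (a m)) < r"
    by eventually_elim simp
  have T: "w1 \<noteq> 0 \<and> w2 \<noteq> 0 \<and> w2\<^sup>2 - w1\<^sup>2 \<noteq> 0" if "(w1, w2) \<in> ?T" for w1 w2
  proof -
    have "cmod (w1\<^sup>2) < 1" "1 < cmod (w2\<^sup>2)"
      using that r by (auto simp: norm_power power_less_one_iff one_less_power)
    then show ?thesis using that r by auto
  qed
  have "uniform_limit ?T (\<lambda>m. scaled_integrand (a m) m p q) (limit_integrand \<nu> p q) sequentially"
  proof (rule uniform_limit_compactI)
    show "compact ?T" by (intro compact_Times) auto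
    show "continuous_on ?T (limit_integrand \<nu> p q)"
      unfolding limit_integrand_def case_prod_unfold
      by (intro continuous_intros) (use T in auto)
    fix x assume x: "x \<in> ?T"
    obtain w1 w2 where xw: "x = (w1, w2)" by (cases x)
    \<comment> \<open>Along this filter the index m (\<open>fst\<close>) and the point of the torus
      (\<open>snd\<close>) vary together.\<close>
    let ?F = "sequentially \<times>\<^sub>F nhds (w1, w2)"
    have fst: "filterlim fst sequentially ?F" by (rule filterlim_fst)
    have snd: "((\<lambda>z. snd z) \<longlongrightarrow> (w1, w2)) ?F" by (rule filterlim_snd)
    have "((\<lambda>z. scaled_integrand (a (fst z)) (fst z) p q (fst (snd z), snd (snd z))) \<longlongrightarrow> limit_integrand \<nu> p q (w1, w2)) ?F"
    proof (rule tendsto_scaled_integrand)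
      show "((\<lambda>z. a (fst z)) \<longlongrightarrow> 0) ?F" by (rule filterlim_compose[OF a0 fst])
      show "((\<lambda>z. real (fst z) * a (fst z)) \<longlongrightarrow> \<nu>) ?F" by (rule filterlim_compose[OF a_lim fst])
      show "\<forall>\<^sub>F z in ?F. a (fst z) \<noteq> 0"
        using eventually_compose_filterlim[OF a_pos fst] by eventually_elim simp
      show "((\<lambda>z. fst (snd z)) \<longlongrightarrow> w1) ?F" using tendsto_fst[OF snd] by simp
      show "((\<lambda>z. snd (snd z)) \<longlongrightarrow> w2) ?F" using tendsto_snd[OF snd] by simp
    qed (use T[of w1 w2] x xw in auto)
    then show "((\<lambda>(m, y). scaled_integrand (a m) m p q y) \<longlongrightarrow> limit_integrand \<nu> p q x) (sequentially \<times>\<^sub>F nhds x)"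
      by (simp add: xw case_prod_unfold)
  qed
  moreover have "\<forall>\<^sub>F m in sequentially. continuous_on ?T (scaled_integrand (a m) m p q)"
    using ev by eventually_elim (use r in \<open>auto intro: continuous_on_scaled_integrand\<close>)
  ultimately have "(\<lambda>m. contour_integral (circlepath 0 r) (\<lambda>w1. 1 / w1 *
       contour_integral (circlepath 0 (1 / r)) (\<lambda>w2. scaled_integrand (a m) m p q (w1, w2))))
    \<longlonglongrightarrow> contour_integral (circlepath 0 r) (\<lambda>w1. 1 / w1 *
       contour_integral (circlepath 0 (1 / r)) (\<lambda>w2. limit_integrand \<nu> p q (w1, w2)))"
    using r by (intro tendsto_double_contour_integral) auto
  then have "(\<lambda>m. 1 / (2 * of_real pi * \<i>)\<^sup>2 * contour_integral (circlepath 0 r) (\<lambda>w1. 1 / w1 *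
       contour_integral (circlepath 0 (1 / r)) (\<lambda>w2. scaled_integrand (a m) m p q (w1, w2))))
    \<longlonglongrightarrow> B00_limit \<nu> r (2 * p) (2 * q)"
    unfolding B00_limit_eq[OF r(1)] by (intro tendsto_mult tendsto_const)
  then show ?thesis
  proof (rule Lim_transform_eventually)
    show "\<forall>\<^sub>F m in sequentially. 1 / (2 * of_real pi * \<i>)\<^sup>2 * contour_integral (circlepath 0 r) (\<lambda>w1. 1 / w1 *
       contour_integral (circlepath 0 (1 / r)) (\<lambda>w2. scaled_integrand (a m) m p q (w1, w2))) =
       - of_real (a m) * \<i> * B00 r (4 * m) (a m) (x_vertex (4 * m) (2 * q)) (y_vertex (4 * m) (2 * p))"
      using ev by eventually_elim (use r scaled_B00_eq in \<open>blast intro: sym\<close>)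
  qed
qed

theorem mainTheorem2:
  fixes a :: "nat \<Rightarrow> real" and \<nu> r :: real and A :: "int set" and M :: int
  assumes a_pos: "\<And>m. m \<ge> 1 \<Longrightarrow> a (4 * m) > 0"
    and nu_pos: "\<nu> > 0"
    and a_lim: "(\<lambda>m. a (4 * m) * real (4 * m)) \<longlonglongrightarrow> 4 * \<nu>"
    and r: "0 < r" "r < 1"
    and A_even: "\<And>\<alpha>. \<alpha> \<in> A \<Longrightarrow> even \<alpha>"
    and A_bounded: "\<And>\<alpha>. \<alpha> \<in> A \<Longrightarrow> \<bar>\<alpha>\<bar> \<le> M"
  shows "uniform_limit (A \<times> A)
           (\<lambda>m (\<alpha>i, \<alpha>j). - of_real (a (4 * m)) * \<i> *
              B00 r (4 * m) (a (4 * m)) (x_vertex (4 * m) \<alpha>j) (y_vertex (4 * m) \<alpha>i))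
           (\<lambda>(\<alpha>i, \<alpha>j). B00_limit \<nu> r \<alpha>i \<alpha>j)
           sequentially
       \<and> (\<forall>\<alpha>i\<in>A. \<forall>\<alpha>j\<in>A. \<forall>R \<rho>. 0 < \<rho> \<and> \<rho> < R \<longrightarrow>
            B00_limit \<nu> r \<alpha>i \<alpha>j =
              (-1) powi ((\<alpha>i - \<alpha>j) div 2) *
              K_Bessel R \<rho> ((of_int \<alpha>i + 1) / 2) ((of_int \<alpha>j + 1) / 2) ((\<nu> / 2)\<^sup>2))"
proof (intro conjI ballI allI impI)
  \<comment> \<open>A bounded set of integers is finite, so uniformity in the two parameters reduces
    to pointwise convergence.\<close>
  have "A \<subseteq> {- M..M}" using A_bounded by (force simp: abs_le_iff)
  then have "finite A" by (rule finite_subset) simp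
  moreover have "(\<lambda>m. - of_real (a (4 * m)) * \<i> *
              B00 r (4 * m) (a (4 * m)) (x_vertex (4 * m) \<alpha>j) (y_vertex (4 * m) \<alpha>i))
       \<longlonglongrightarrow> B00_limit \<nu> r \<alpha>i \<alpha>j" if in_A: "\<alpha>i \<in> A" "\<alpha>j \<in> A" for \<alpha>i \<alpha>j
  proof -
    obtain p q where pq: "\<alpha>i = 2 * p" "\<alpha>j = 2 * q" using A_even[OF in_A(1)] A_even[OF in_A(2)] by (auto elim!: evenE)
    \<comment> \<open>With n = 4m, the hypothesis a n \<rightarrow> 4 \<nu> says that m * a tends to
      \<nu>, where m is the exponent of D.\<close>
    have "(\<lambda>m. 1 / 4 * (a (4 * m) * real (4 * m))) \<longlonglongrightarrow> 1 / 4 * (4 * \<nu>)"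
      by (intro tendsto_mult tendsto_const a_lim)
    then have "(\<lambda>m. real m * a (4 * m)) \<longlonglongrightarrow> \<nu>" by (simp add: mult_ac)
    moreover have "\<forall>\<^sub>F m in sequentially. a (4 * m) > 0"
      using eventually_ge_at_top[of 1] by eventually_elim (rule a_pos)
    ultimately show ?thesis
      unfolding pq using r by (intro scaled_B00_tendsto)
  qed
  ultimately show "uniform_limit (A \<times> A)
           (\<lambda>m (\<alpha>i, \<alpha>j). - of_real (a (4 * m)) * \<i> *
              B00 r (4 * m) (a (4 * m)) (x_vertex (4 * m) \<alpha>j) (y_vertex (4 * m) \<alpha>i))
           (\<lambda>(\<alpha>i, \<alpha>j). B00_limit \<nu> r \<alpha>i \<alpha>j)
           sequentially"
    by (intro uniform_limit_finite) auto
next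
  fix \<alpha>i \<alpha>j and R \<rho> :: real
  assume "\<alpha>i \<in> A" "\<alpha>j \<in> A" and radii: "0 < \<rho> \<and> \<rho> < R"
  then obtain p q where pq: "\<alpha>i = 2 * p" "\<alpha>j = 2 * q" using A_even by (meson evenE)
  then have "(\<alpha>i - \<alpha>j) div 2 = p - q" by simp
  then show "B00_limit \<nu> r \<alpha>i \<alpha>j =
              (-1) powi ((\<alpha>i - \<alpha>j) div 2) *
              K_Bessel R \<rho> ((of_int \<alpha>i + 1) / 2) ((of_int \<alpha>j + 1) / 2) ((\<nu> / 2)\<^sup>2)"
    unfolding pq using B00_limit_eq_K_Bessel[OF r, of \<nu> \<rho> R p q] nu_pos radii by simp
qed

end
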